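(* Let $S$ be a finitely subdirectly irreducible bias. Then the type monoid $\operatorname{Typ}S$ is prime.
   Context: A semigroup $S$ is inverse if every $x\in S$ has a unique $x^{-1}$ with $x=xx^{-1}x$ and $x^{-1}=x^{-1}xx^{-1}$. Put $\mathbf d(x)=x^{-1}x$, $\mathbf r(x)=xx^{-1}$; $\operatorname{Idp}S$ is the set of idempotents; the natural ordering is $x\le y$ iff $x=y\,\mathbf d(x)$. In an inverse semigroup with zero, $x,y$ are orthogonal if $x^{-1}y=xy^{-1}=0$. A Boolean inverse semigroup is an inverse semigroup $S$ with zero such that $\operatorname{Idp}S$ is a generalized Boolean algebra and any two orthogonal $x,y$ have a join $x\oplus y$ for the natural ordering. On a Boolean inverse semigroup define $x\oslash y=(\mathbf r(x)\smallsetminus\mathbf r(y))\,x\,(\mathbf d(x)\smallsetminus\mathbf d(y))$ and $x\triangledown y=(x\oslash y)\oplus y$. Boolean inverse semigroups, viewed as algebras $(S,0,{}^{-1},\cdot,\oslash,\triangledown)$, are called biases; they form a variety. A bias congruence is a congruence for all these operations; equivalently, it is an inverse semigroup congruence $\boldsymbol\theta$ such that for all $x\in S$ and all orthogonal idempotents $a,b$, if $xa\equiv a$ and $xb\equiv b$ modulo $\boldsymbol\theta$ then $x(a\oplus b)\equiv a\oplus b$ modulo $\boldsymbol\theta$. A bias is finitely subdirectly irreducible if any two nonzero (i.e. distinct from the identity) bias congruences have nonzero intersection. Type monoid: $\mathscr D=\mathscr L\circ\mathscr R$, where $x\mathscr L y$ iff $\mathbf d(x)=\mathbf d(y)$ and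 $x\mathscr R y$ iff $\mathbf r(x)=\mathbf r(y)$. $\operatorname{Int}S$ is the set of $\mathscr D$-classes with the partial addition $x/\mathscr D+y/\mathscr D=(x\oplus y)/\mathscr D$ for orthogonal $x,y$; $\operatorname{Typ}S$ is its universal (commutative) monoid; it is conical ($x+y=0$ implies $x=y=0$). A conical commutative monoid $M$, preordered by $x\le^+y$ iff $x+z=y$ for some $z\in M$, is prime if $M\setminus\{0\}$ is downward directed, i.e. any two nonzero elements of $M$ have a nonzero common lower bound for $\le^+$. *)

theory Defs
  imports "HOL-Algebra.FiniteProduct" "HOL-Library.Multiset"
begin

section \<open>Boolean inverse semigroups\<close>

record 'a semigroup0 = "'a partial_object" +
  smult :: "'a \<Rightarrow> 'a \<Rightarrow> 'a" (infixl \<open>\<cdot>\<index>\<close> 70)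
  szero :: 'a

definition generalized_inverse :: "('a, 'm) semigroup0_scheme \<Rightarrow> 'a \<Rightarrow> 'a \<Rightarrow> bool" where
  "generalized_inverse S x y \<longleftrightarrow> x = x \<cdot>\<^bsub>S\<^esub> y \<cdot>\<^bsub>S\<^esub> x \<and> y = y \<cdot>\<^bsub>S\<^esub> x \<cdot>\<^bsub>S\<^esub> y"

locale inverse_semigroup0 =
  fixes S (structure)
  assumes smult_closed: "\<lbrakk>x \<in> carrier S; y \<in> carrier S\<rbrakk> \<Longrightarrow> x \<cdot> y \<in> carrier S"
    and smult_assoc:
      "\<lbrakk>x \<in> carrier S; y \<in> carrier S; z \<in> carrier S\<rbrakk> \<Longrightarrow> x \<cdot> y \<cdot> z = x \<cdot> (y \<cdot> z)"
    and unique_inverse: "x \<in> carrier S \<Longrightarrow> \<exists>!y. y \<in> carrier S \<and> generalized_inverse S x y"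
    and szero_closed: "szero S \<in> carrier S"
    and szero_left: "x \<in> carrier S \<Longrightarrow> szero S \<cdot> x = szero S"
    and szero_right: "x \<in> carrier S \<Longrightarrow> x \<cdot> szero S = szero S"

definition sinv :: "('a, 'm) semigroup0_scheme \<Rightarrow> 'a \<Rightarrow> 'a" where
  "sinv S x = (THE y. y \<in> carrier S \<and> generalized_inverse S x y)"

definition dom_idp :: "('a, 'm) semigroup0_scheme \<Rightarrow> 'a \<Rightarrow> 'a" where
  "dom_idp S x = sinv S x \<cdot>\<^bsub>S\<^esub> x"

definition rng_idp :: "('a, 'm) semigroup0_scheme \<Rightarrow> 'a \<Rightarrow> 'a" where
  "rng_idp S x = x \<cdot>\<^bsub>S\<^esub> sinv S x"

definition Idp :: "('a, 'm) semigroup0_scheme \<Rightarrow> 'a set" where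
  "Idp S = {a \<in> carrier S. a \<cdot>\<^bsub>S\<^esub> a = a}"

definition nat_order :: "('a, 'm) semigroup0_scheme \<Rightarrow> 'a gorder" where
  "nat_order S = \<lparr>carrier = carrier S, eq = (=), le = (\<lambda>x y. x = y \<cdot>\<^bsub>S\<^esub> dom_idp S x)\<rparr>"

definition Idp_order :: "('a, 'm) semigroup0_scheme \<Rightarrow> 'a gorder" where
  "Idp_order S = (nat_order S)\<lparr>carrier := Idp S\<rparr>"

definition orthogonal :: "('a, 'm) semigroup0_scheme \<Rightarrow> 'a \<Rightarrow> 'a \<Rightarrow> bool" where
  "orthogonal S x y \<longleftrightarrow> sinv S x \<cdot>\<^bsub>S\<^esub> y = szero S \<and> x \<cdot>\<^bsub>S\<^esub> sinv S y = szero S"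

text \<open>A generalized Boolean algebra is a distributive lattice with a least element in which every
  initial interval is complemented; there need not be a greatest element.\<close>

locale generalized_boolean_algebra = lattice L + weak_partial_order_bottom L for L (structure) +
  assumes meet_join_distrib:
      "\<lbrakk>a \<in> carrier L; b \<in> carrier L; c \<in> carrier L\<rbrakk> \<Longrightarrow> a \<sqinter> (b \<squnion> c) = (a \<sqinter> b) \<squnion> (a \<sqinter> c)"
    and sectionally_complemented:
      "\<lbrakk>a \<in> carrier L; b \<in> carrier L; b \<sqsubseteq> a\<rbrakk> \<Longrightarrow> \<exists>c \<in> carrier L. b \<sqinter> c = \<bottom> \<and> b \<squnion> c = a"

text \<open>The difference of \<open>a\<close> and \<open>b\<close> is the complement of \<open>a \<sqinter> b\<close> in the interval below \<open>a\<close>;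
  it is unique by distributivity.\<close>

definition gba_diff :: "('a, 'm) gorder_scheme \<Rightarrow> 'a \<Rightarrow> 'a \<Rightarrow> 'a" where
  "gba_diff L a b = (THE c. c \<in> carrier L \<and>
     (a \<sqinter>\<^bsub>L\<^esub> b) \<sqinter>\<^bsub>L\<^esub> c = \<bottom>\<^bsub>L\<^esub> \<and> (a \<sqinter>\<^bsub>L\<^esub> b) \<squnion>\<^bsub>L\<^esub> c = a)"

locale boolean_inverse_semigroup = inverse_semigroup0 +
  assumes Idp_gba: "generalized_boolean_algebra (Idp_order S)"
    and orthogonal_join: "\<lbrakk>x \<in> carrier S; y \<in> carrier S; orthogonal S x y\<rbrakk>
      \<Longrightarrow> \<exists>z. is_lub (nat_order S) z {x, y}"

definition osum :: "('a, 'm) semigroup0_scheme \<Rightarrow> 'a \<Rightarrow> 'a \<Rightarrow> 'a" where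
  "osum S x y = x \<squnion>\<^bsub>nat_order S\<^esub> y"


section \<open>Biases and their congruences\<close>

text \<open>The bias operations are all determined by the underlying semigroup with zero, so a bias is
  represented by that semigroup.\<close>

abbreviation bias :: "('a, 'm) semigroup0_scheme \<Rightarrow> bool" where
  "bias \<equiv> boolean_inverse_semigroup"

definition skew_diff :: "('a, 'm) semigroup0_scheme \<Rightarrow> 'a \<Rightarrow> 'a \<Rightarrow> 'a" where
  "skew_diff S x y =
     gba_diff (Idp_order S) (rng_idp S x) (rng_idp S y) \<cdot>\<^bsub>S\<^esub> x
       \<cdot>\<^bsub>S\<^esub> gba_diff (Idp_order S) (dom_idp S x) (dom_idp S y)"

definition skew_add :: "('a, 'm) semigroup0_scheme \<Rightarrow> 'a \<Rightarrow> 'a \<Rightarrow> 'a" where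
  "skew_add S x y = osum S (skew_diff S x y) y"

definition preserves1 :: "('a \<times> 'a) set \<Rightarrow> ('a \<Rightarrow> 'a) \<Rightarrow> bool" where
  "preserves1 \<theta> f \<longleftrightarrow> (\<forall>(x, x') \<in> \<theta>. (f x, f x') \<in> \<theta>)"

definition preserves2 :: "('a \<times> 'a) set \<Rightarrow> ('a \<Rightarrow> 'a \<Rightarrow> 'a) \<Rightarrow> bool" where
  "preserves2 \<theta> f \<longleftrightarrow> (\<forall>(x, x') \<in> \<theta>. \<forall>(y, y') \<in> \<theta>. (f x y, f x' y') \<in> \<theta>)"

definition bias_congruence :: "('a, 'm) semigroup0_scheme \<Rightarrow> ('a \<times> 'a) set \<Rightarrow> bool" where
  "bias_congruence S \<theta> \<longleftrightarrow> equiv (carrier S) \<theta> \<and>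
     preserves1 \<theta> (sinv S) \<and> preserves2 \<theta> (smult S) \<and>
     preserves2 \<theta> (skew_diff S) \<and> preserves2 \<theta> (skew_add S)"

definition finitely_subdirectly_irreducible :: "('a, 'm) semigroup0_scheme \<Rightarrow> bool" where
  "finitely_subdirectly_irreducible S \<longleftrightarrow>
     (\<forall>\<alpha> \<beta>. bias_congruence S \<alpha> \<and> \<alpha> \<noteq> Id_on (carrier S) \<and>
            bias_congruence S \<beta> \<and> \<beta> \<noteq> Id_on (carrier S) \<longrightarrow>
            \<alpha> \<inter> \<beta> \<noteq> Id_on (carrier S))"


section \<open>The universal monoid of a partial commutative monoid\<close>

text \<open>A partial monoid is given by its carrier \<open>P\<close>, the graph \<open>add\<close> of its partial addition
  (\<open>add x y w\<close> means that \<open>x + y\<close> is defined and equal to \<open>w\<close>) and its zero \<open>z\<close>.  Its universal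
  monoid is the quotient of the free commutative monoid on \<open>P\<close> by the least monoid congruence
  which identifies \<open>z\<close> with the neutral element and each defined sum with the corresponding formal
  sum.  The resulting monoid is written multiplicatively, as always in HOL-Algebra.\<close>

inductive_set univ_cong ::
    "'b set \<Rightarrow> ('b \<Rightarrow> 'b \<Rightarrow> 'b \<Rightarrow> bool) \<Rightarrow> 'b \<Rightarrow> ('b multiset \<times> 'b multiset) set"
  for P :: "'b set" and add :: "'b \<Rightarrow> 'b \<Rightarrow> 'b \<Rightarrow> bool" and z :: 'b where
  zero: "z \<in> P \<Longrightarrow> ({#z#}, {#}) \<in> univ_cong P add z"
| sum: "\<lbrakk>x \<in> P; y \<in> P; w \<in> P; add x y w\<rbrakk> \<Longrightarrow> ({#w#}, {#x, y#}) \<in> univ_cong P add z"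
| plus: "\<lbrakk>(A, A') \<in> univ_cong P add z; (B, B') \<in> univ_cong P add z\<rbrakk>
    \<Longrightarrow> (A + B, A' + B') \<in> univ_cong P add z"
| refl: "set_mset A \<subseteq> P \<Longrightarrow> (A, A) \<in> univ_cong P add z"
| sym: "(A, B) \<in> univ_cong P add z \<Longrightarrow> (B, A) \<in> univ_cong P add z"
| trans: "\<lbrakk>(A, B) \<in> univ_cong P add z; (B, C) \<in> univ_cong P add z\<rbrakk>
    \<Longrightarrow> (A, C) \<in> univ_cong P add z"

definition univ_class ::
    "'b set \<Rightarrow> ('b \<Rightarrow> 'b \<Rightarrow> 'b \<Rightarrow> bool) \<Rightarrow> 'b \<Rightarrow> 'b multiset \<Rightarrow> 'b multiset set" where
  "univ_class P add z A = univ_cong P add z `` {A}"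

definition univ_monoid ::
    "'b set \<Rightarrow> ('b \<Rightarrow> 'b \<Rightarrow> 'b \<Rightarrow> bool) \<Rightarrow> 'b \<Rightarrow> 'b multiset set monoid" where
  "univ_monoid P add z =
     \<lparr>carrier = {A. set_mset A \<subseteq> P} // univ_cong P add z,
      monoid.mult = (\<lambda>X Y. \<Union>A\<in>X. \<Union>B\<in>Y. univ_class P add z (A + B)),
      one = univ_class P add z {#}\<rparr>"

lemma univ_cong_subset:
  assumes "(A, B) \<in> univ_cong P add z"
  shows "set_mset A \<subseteq> P \<and> set_mset B \<subseteq> P"
  using assms by induction auto

lemma equiv_univ_cong: "equiv {A. set_mset A \<subseteq> P} (univ_cong P add z)"
proof (rule equivI)
  show "univ_cong P add z \<subseteq> {A. set_mset A \<subseteq> P} \<times> {A. set_mset A \<subseteq> P}"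
    using univ_cong_subset by fastforce
  show "refl_on {A. set_mset A \<subseteq> P} (univ_cong P add z)"
    by (auto simp: refl_on_def intro: univ_cong.refl)
  show "sym (univ_cong P add z)"
    by (auto simp: sym_def intro: univ_cong.sym)
  show "trans (univ_cong P add z)"
    by (meson transI univ_cong.trans)
qed

lemma univ_class_eq_iff:
  "\<lbrakk>set_mset A \<subseteq> P; set_mset B \<subseteq> P\<rbrakk>
    \<Longrightarrow> univ_class P add z A = univ_class P add z B \<longleftrightarrow> (A, B) \<in> univ_cong P add z"
  unfolding univ_class_def by (rule eq_equiv_class_iff[OF equiv_univ_cong]) auto

lemma carrier_univ_monoid:
  "carrier (univ_monoid P add z) = univ_class P add z ` {A. set_mset A \<subseteq> P}"
  by (auto simp: univ_monoid_def quotient_def univ_class_def)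

lemma one_univ_monoid: "\<one>\<^bsub>univ_monoid P add z\<^esub> = univ_class P add z {#}"
  by (simp add: univ_monoid_def)

lemma mult_univ_monoid:
  assumes A: "set_mset A \<subseteq> P" and B: "set_mset B \<subseteq> P"
  shows "univ_class P add z A \<otimes>\<^bsub>univ_monoid P add z\<^esub> univ_class P add z B
    = univ_class P add z (A + B)"
proof -
  have *: "univ_class P add z (A' + B') = univ_class P add z (A + B)"
    if "A' \<in> univ_class P add z A" "B' \<in> univ_class P add z B" for A' B'
  proof -
    have "(A, A') \<in> univ_cong P add z" "(B, B') \<in> univ_cong P add z"
      using that by (auto simp: univ_class_def)
    then have "(A + B, A' + B') \<in> univ_cong P add z" by (rule univ_cong.plus)
    then show ?thesis
      unfolding univ_class_def by (rule equiv_class_eq[OF equiv_univ_cong, symmetric])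
  qed
  have "A \<in> univ_class P add z A" "B \<in> univ_class P add z B"
    using A B by (auto simp: univ_class_def intro: univ_cong.refl)
  then have "(\<Union>A'\<in>univ_class P add z A. \<Union>B'\<in>univ_class P add z B. univ_class P add z (A' + B'))
      = univ_class P add z (A + B)"
    using * by blast
  then show ?thesis by (simp add: univ_monoid_def)
qed

lemma comm_monoid_univ_monoid: "comm_monoid (univ_monoid P add z)"
  by (rule comm_monoidI)
    (auto simp: carrier_univ_monoid one_univ_monoid mult_univ_monoid union_ac)

text \<open>The universal property: homomorphisms from the partial monoid into a commutative monoid
  \<open>N\<close> extend uniquely to the universal monoid.\<close>

lemma (in comm_monoid) univ_monoid_extension:
  assumes f: "f \<in> P \<rightarrow> carrier G"
    and f_zero: "f z = \<one>"
    and f_sum: "\<And>x y w. \<lbrakk>x \<in> P; y \<in> P; w \<in> P; add x y w\<rbrakk> \<Longrightarrow> f w = f x \<otimes> f y"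
  shows "\<exists>h \<in> hom (univ_monoid P add z) G. h \<one>\<^bsub>univ_monoid P add z\<^esub> = \<one> \<and>
    (\<forall>x\<in>P. h (univ_class P add z {#x#}) = f x)"
proof -
  define F where "F A = finprod G (\<lambda>x. f x [^] count A x) (set_mset A)" for A
  have pow: "f x [^] (n::nat) \<in> carrier G" if "x \<in> P" for x n
    using f that by auto
  have F_closed: "F A \<in> carrier G" if "set_mset A \<subseteq> P" for A
    unfolding F_def using that pow by (intro finprod_closed) auto
  have F_ext: "F A = finprod G (\<lambda>x. f x [^] count A x) Q"
    if "finite Q" "set_mset A \<subseteq> Q" "Q \<subseteq> P" for A Q
    unfolding F_def
    by (rule finprod_mono_neutral_cong_left)
      (use that pow in \<open>auto simp: not_in_iff\<close>)
  have F_plus: "F (A + B) = F A \<otimes> F B" if "set_mset A \<subseteq> P" "set_mset B \<subseteq> P" for A B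
  proof -
    let ?Q = "set_mset A \<union> set_mset B"
    have Q: "finite ?Q" "?Q \<subseteq> P" using that by auto
    have "F (A + B) = finprod G (\<lambda>x. f x [^] count (A + B) x) ?Q"
      using Q by (intro F_ext) auto
    also have "\<dots> = finprod G (\<lambda>x. f x [^] count A x \<otimes> f x [^] count B x) ?Q"
    proof (intro finprod_cong')
      fix x assume "x \<in> ?Q"
      then have "f x \<in> carrier G" using Q f by blast
      then show "f x [^] count (A + B) x = f x [^] count A x \<otimes> f x [^] count B x"
        by (simp add: nat_pow_mult)
    qed (use Q pow in auto)
    also have "\<dots> = finprod G (\<lambda>x. f x [^] count A x) ?Q \<otimes> finprod G (\<lambda>x. f x [^] count B x) ?Q"
      using Q pow by (intro finprod_multf) auto
    also have "\<dots> = F A \<otimes> F B"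
      using Q by (simp add: F_ext[of ?Q])
    finally show ?thesis .
  qed
  have F_single: "F {#x#} = f x" if "x \<in> P" for x
    using that f by (auto simp: F_def Pi_iff)
  have F_empty: "F {#} = \<one>" by (simp add: F_def)
  have F_cong: "F A = F B" if "(A, B) \<in> univ_cong P add z" for A B
    using that
  proof induction
    case (sum x y w)
    have "F {#x, y#} = F ({#x#} + {#y#})" by (simp add: add_mset_commute)
    also have "\<dots> = f x \<otimes> f y" using sum by (subst F_plus) (auto simp: F_single)
    finally show ?case using sum f_sum by (simp add: F_single)
  next
    case (plus A A' B B')
    have "set_mset A \<subseteq> P" "set_mset A' \<subseteq> P" "set_mset B \<subseteq> P" "set_mset B' \<subseteq> P"
      using plus.hyps univ_cong_subset by fastforce+
    then show ?case by (simp add: F_plus plus.IH)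
  qed (auto simp: F_single F_empty f_zero)
  define h where "h X = F (SOME A. A \<in> X)" for X
  have h_class: "h (univ_class P add z A) = F A" if "set_mset A \<subseteq> P" for A
  proof -
    have "A \<in> univ_class P add z A"
      using that by (auto simp: univ_class_def intro: univ_cong.refl)
    then have "(SOME B. B \<in> univ_class P add z A) \<in> univ_class P add z A" by (rule someI)
    then show ?thesis unfolding h_def by (intro F_cong[symmetric]) (simp add: univ_class_def)
  qed
  have "h \<in> hom (univ_monoid P add z) G"
    by (rule homI) (auto simp: carrier_univ_monoid mult_univ_monoid h_class F_closed F_plus)
  moreover have "h \<one>\<^bsub>univ_monoid P add z\<^esub> = \<one>"
    by (simp add: one_univ_monoid h_class F_empty)
  moreover have "h (univ_class P add z {#x#}) = f x" if "x \<in> P" for x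
    using that by (simp add: h_class F_single)
  ultimately show ?thesis by blast
qed

lemma univ_monoid_extension_unique:
  assumes h: "h \<in> hom (univ_monoid P add z) N" "h \<one>\<^bsub>univ_monoid P add z\<^esub> = \<one>\<^bsub>N\<^esub>"
    and k: "k \<in> hom (univ_monoid P add z) N" "k \<one>\<^bsub>univ_monoid P add z\<^esub> = \<one>\<^bsub>N\<^esub>"
    and eq: "\<And>x. x \<in> P \<Longrightarrow> h (univ_class P add z {#x#}) = k (univ_class P add z {#x#})"
    and X: "X \<in> carrier (univ_monoid P add z)"
  shows "h X = k X"
proof -
  have "h (univ_class P add z A) = k (univ_class P add z A)" if "set_mset A \<subseteq> P" for A
    using that
  proof (induction A)
    case empty
    then show ?case using h k by (simp add: one_univ_monoid)
  next
    case (add x A)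
    then have x: "x \<in> P" "set_mset A \<subseteq> P" by auto
    have split: "univ_class P add z (add_mset x A) =
        univ_class P add z {#x#} \<otimes>\<^bsub>univ_monoid P add z\<^esub> univ_class P add z A"
      using x by (simp add: mult_univ_monoid)
    have "univ_class P add z {#x#} \<in> carrier (univ_monoid P add z)"
      "univ_class P add z A \<in> carrier (univ_monoid P add z)"
      using x by (auto simp: carrier_univ_monoid)
    then show ?case
      using x add.IH eq h(1) k(1) by (simp add: split hom_mult)
  qed
  then show ?thesis using X by (auto simp: carrier_univ_monoid)
qed


section \<open>The type monoid\<close>

definition green_L :: "('a, 'm) semigroup0_scheme \<Rightarrow> ('a \<times> 'a) set" where
  "green_L S = {(x, y). x \<in> carrier S \<and> y \<in> carrier S \<and> dom_idp S x = dom_idp S y}"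

definition green_R :: "('a, 'm) semigroup0_scheme \<Rightarrow> ('a \<times> 'a) set" where
  "green_R S = {(x, y). x \<in> carrier S \<and> y \<in> carrier S \<and> rng_idp S x = rng_idp S y}"

definition green_D :: "('a, 'm) semigroup0_scheme \<Rightarrow> ('a \<times> 'a) set" where
  "green_D S = green_L S O green_R S"

definition Int_dim :: "('a, 'm) semigroup0_scheme \<Rightarrow> 'a set set" where
  "Int_dim S = carrier S // green_D S"

definition Int_add :: "('a, 'm) semigroup0_scheme \<Rightarrow> 'a set \<Rightarrow> 'a set \<Rightarrow> 'a set \<Rightarrow> bool" where
  "Int_add S A B C \<longleftrightarrow>
     (\<exists>x\<in>A. \<exists>y\<in>B. orthogonal S x y \<and> C = green_D S `` {osum S x y})"

definition Typ :: "('a, 'm) semigroup0_scheme \<Rightarrow> 'a set multiset set monoid" where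
  "Typ S = univ_monoid (Int_dim S) (Int_add S) (green_D S `` {szero S})"


section \<open>Prime monoids\<close>

definition conical :: "('b, 'n) monoid_scheme \<Rightarrow> bool" where
  "conical M \<longleftrightarrow> (\<forall>x\<in>carrier M. \<forall>y\<in>carrier M. x \<otimes>\<^bsub>M\<^esub> y = \<one>\<^bsub>M\<^esub> \<longrightarrow> x = \<one>\<^bsub>M\<^esub> \<and> y = \<one>\<^bsub>M\<^esub>)"

definition alg_le :: "('b, 'n) monoid_scheme \<Rightarrow> 'b \<Rightarrow> 'b \<Rightarrow> bool" where
  "alg_le M x y \<longleftrightarrow> (\<exists>z\<in>carrier M. x \<otimes>\<^bsub>M\<^esub> z = y)"

text \<open>The trivial monoid counts as prime, since it has no two nonzero elements to be bounded.\<close>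

definition prime_monoid :: "('b, 'n) monoid_scheme \<Rightarrow> bool" where
  "prime_monoid M \<longleftrightarrow> comm_monoid M \<and> conical M \<and>
     (\<forall>x \<in> carrier M - {\<one>\<^bsub>M\<^esub>}. \<forall>y \<in> carrier M - {\<one>\<^bsub>M\<^esub>}.
        \<exists>w \<in> carrier M - {\<one>\<^bsub>M\<^esub>}. alg_le M w x \<and> alg_le M w y)"

end

theory Submission
  imports Defs
begin

text \<open>
  Two nonzero elements of the type monoid dominate nonzero classes \<open>c/\<D>\<close> and \<open>c'/\<D>\<close>; put
  \<open>a = d(c)\<close> and \<open>b = d(c')\<close>, two nonzero idempotents.  If some \<open>s\<close> satisfies \<open>x = a s b \<noteq> 0\<close>,
  then \<open>r(x) \<le> a\<close> and \<open>d(x) \<le> b\<close> are \<open>\<D>\<close>-equivalent to \<open>x\<close>, so \<open>x/\<D>\<close> is a common lower bound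
  (\<open>Typ_class_below\<close>: every idempotent below \<open>d(c)\<close> splits \<open>c\<close> into an orthogonal sum).
  It is not zero in the type monoid, because no defining relation of that monoid identifies
  a formal sum of zero classes with one that has a nonzero summand (\<open>Typ_cong_zero_iff\<close>); the same
  invariant gives conicality.

  Suppose now that \<open>a s b = 0\<close> for all \<open>s\<close>.  The idempotents \<open>e\<close> with \<open>a s e = 0\<close> for all \<open>s\<close> form an
  ideal \<open>I\<close>, closed under joins by distributivity and under \<open>e \<mapsto> t\<^sup>-\<^sup>1 e t\<close>, and \<open>b \<in> I\<close>.
  The same construction applied to \<open>I\<close> instead of \<open>{a}\<close> gives an ideal \<open>J\<close> that contains \<open>a\<close> and meets \<open>I\<close> only in \<open>0\<close>, since an idempotent
  \<open>e\<close> in both satisfies \<open>e = e e e = 0\<close>.  Every such ideal defines a bias congruence: \<open>x\<close> and \<open>y\<close> are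
  congruent when they agree off some member of the ideal
  (\<open>bias_congruence_ideal_cong\<close>).  The congruences of \<open>I\<close> and \<open>J\<close> are not the identity, as they
  send \<open>b\<close>, respectively \<open>a\<close>, to zero.  Their intersection is the identity
  (\<open>ideal_cong_Int_disjoint\<close>): elements that agree off \<open>e \<in> I\<close> and off \<open>f \<in> J\<close>, where \<open>e f = 0\<close>, agree
  everywhere.  This contradicts finite subdirect irreducibility.

  Agreement on pieces is glued by \<open>agree_on_join\<close>: elements that agree on two orthogonal
  idempotents agree on their join.  Its proof compares the join in the lattice of idempotents with
  the orthogonal join in the whole semigroup.
\<close>

section \<open>Inverse semigroups with zero\<close>

context inverse_semigroup0
begin

declare smult_closed [simp, intro] szero_closed [simp, intro] szero_left [simp] szero_right [simp]

lemma sinv_props: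
  assumes "x \<in> carrier S"
  shows "sinv S x \<in> carrier S" "generalized_inverse S x (sinv S x)"
  using theI'[OF unique_inverse[OF assms]] unfolding sinv_def by auto

lemma sinv_closed [simp, intro]: "x \<in> carrier S \<Longrightarrow> sinv S x \<in> carrier S"
  by (rule sinv_props)

lemma mult_sinv_mult [simp]:
  "x \<in> carrier S \<Longrightarrow> x \<cdot> (sinv S x \<cdot> x) = x"
  "x \<in> carrier S \<Longrightarrow> sinv S x \<cdot> (x \<cdot> sinv S x) = sinv S x"
  using sinv_props[of x] by (auto simp: generalized_inverse_def smult_assoc)

lemma mult_sinv_mult_assoc [simp]:
  assumes "x \<in> carrier S" "y \<in> carrier S"
  shows "x \<cdot> (sinv S x \<cdot> (x \<cdot> y)) = x \<cdot> y" "sinv S x \<cdot> (x \<cdot> (sinv S x \<cdot> y)) = sinv S x \<cdot> y"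
  using mult_sinv_mult[OF assms(1)] assms by (metis smult_assoc smult_closed sinv_closed)+

lemma sinv_unique:
  assumes "x \<in> carrier S" "y \<in> carrier S" "x \<cdot> (y \<cdot> x) = x" "y \<cdot> (x \<cdot> y) = y"
  shows "sinv S x = y"
  unfolding sinv_def
  by (rule the1_equality[OF unique_inverse])
     (use assms in \<open>simp_all add: generalized_inverse_def smult_assoc\<close>)

lemma sinv_sinv [simp]: "x \<in> carrier S \<Longrightarrow> sinv S (sinv S x) = x"
  by (rule sinv_unique) auto

lemma IdpI: "e \<in> carrier S \<Longrightarrow> e \<cdot> e = e \<Longrightarrow> e \<in> Idp S"
  by (simp add: Idp_def)

lemma IdpD [simp]:
  assumes "e \<in> Idp S"
  shows "e \<in> carrier S" "e \<cdot> e = e" "x \<in> carrier S \<Longrightarrow> e \<cdot> (e \<cdot> x) = e \<cdot> x"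
  using assms by (auto simp: Idp_def smult_assoc[symmetric])

lemma sinv_Idp [simp]: "e \<in> Idp S \<Longrightarrow> sinv S e = e"
  by (rule sinv_unique) auto

text \<open>With \<open>x\<close> the inverse of \<open>e f\<close>, the element \<open>f x e\<close> is another inverse of \<open>e f\<close>.  Uniqueness
  gives \<open>x = f x e\<close>, which is idempotent and therefore its own inverse; so \<open>e f = x\<close>.\<close>

lemma Idp_mult [simp, intro]:
  assumes e: "e \<in> Idp S" and f: "f \<in> Idp S"
  shows "e \<cdot> f \<in> Idp S"
proof -
  define x where "x = sinv S (e \<cdot> f)"
  have x: "x \<in> carrier S" using e f by (simp add: x_def)
  have i1: "e \<cdot> (f \<cdot> (x \<cdot> (e \<cdot> f))) = e \<cdot> f" and i2: "x \<cdot> (e \<cdot> (f \<cdot> x)) = x"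
    using mult_sinv_mult[of "e \<cdot> f"] e f x by (simp_all add: x_def[symmetric] smult_assoc)
  have i2': "x \<cdot> (e \<cdot> (f \<cdot> (x \<cdot> e))) = x \<cdot> e"
    using i2 e f x by (metis IdpD(1) smult_assoc smult_closed)
  have "sinv S (e \<cdot> f) = f \<cdot> (x \<cdot> e)"
    by (rule sinv_unique) (use e f x i1 i2' in \<open>simp_all add: smult_assoc\<close>)
  then have x_eq: "f \<cdot> (x \<cdot> e) = x" by (simp add: x_def)
  have "x \<cdot> x = (f \<cdot> (x \<cdot> e)) \<cdot> (f \<cdot> (x \<cdot> e))" by (simp only: x_eq)
  also have "\<dots> = f \<cdot> (x \<cdot> e)" using e f x i2' by (simp add: smult_assoc)
  also have "\<dots> = x" by (rule x_eq)
  finally have "x \<in> Idp S" using x by (rule IdpI[rotated])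
  have "e \<cdot> f = sinv S x" using e f by (simp add: x_def)
  also have "\<dots> = x" by (rule sinv_Idp) fact
  finally have "e \<cdot> f = x" .
  with \<open>x \<in> Idp S\<close> show ?thesis by simp
qed

text \<open>Now that \<open>e f\<close> and \<open>f e\<close> are idempotent, both \<open>f e\<close> and \<open>e f\<close> are inverses of \<open>e f\<close>.\<close>

lemma Idp_commute:
  assumes e: "e \<in> Idp S" and f: "f \<in> Idp S"
  shows "e \<cdot> f = f \<cdot> e"
proof -
  have 1: "e \<cdot> (f \<cdot> (e \<cdot> f)) = e \<cdot> f" and 2: "f \<cdot> (e \<cdot> (f \<cdot> e)) = f \<cdot> e"
    using IdpD(2)[OF Idp_mult[OF e f]] IdpD(2)[OF Idp_mult[OF f e]] e f
    by (simp_all only: smult_assoc smult_closed IdpD(1))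
  have "sinv S (e \<cdot> f) = f \<cdot> e"
    by (rule sinv_unique) (use e f 1 2 in \<open>simp_all add: smult_assoc\<close>)
  then show ?thesis using e f by simp
qed

lemma Idp_left_commute:
  assumes "e \<in> Idp S" "f \<in> Idp S" "x \<in> carrier S"
  shows "e \<cdot> (f \<cdot> x) = f \<cdot> (e \<cdot> x)"
  using assms Idp_commute by (metis IdpD(1) smult_assoc)

lemma Idp_sinv_mult [simp, intro]:
  "x \<in> carrier S \<Longrightarrow> sinv S x \<cdot> x \<in> Idp S"
  "x \<in> carrier S \<Longrightarrow> x \<cdot> sinv S x \<in> Idp S"
  by (rule IdpI; simp add: smult_assoc)+

lemma sinv_mult:
  assumes x: "x \<in> carrier S" and y: "y \<in> carrier S"
  shows "sinv S (x \<cdot> y) = sinv S y \<cdot> sinv S x"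
proof (rule sinv_unique)
  have "x \<cdot> y \<cdot> (sinv S y \<cdot> sinv S x \<cdot> (x \<cdot> y)) = x \<cdot> ((y \<cdot> sinv S y) \<cdot> ((sinv S x \<cdot> x) \<cdot> y))"
    using x y by (simp add: smult_assoc)
  also have "\<dots> = x \<cdot> ((sinv S x \<cdot> x) \<cdot> ((y \<cdot> sinv S y) \<cdot> y))"
    by (subst Idp_left_commute) (use x y in auto)
  also have "\<dots> = x \<cdot> y" using x y by (simp add: smult_assoc)
  finally show "x \<cdot> y \<cdot> (sinv S y \<cdot> sinv S x \<cdot> (x \<cdot> y)) = x \<cdot> y" .
  have "sinv S y \<cdot> sinv S x \<cdot> (x \<cdot> y \<cdot> (sinv S y \<cdot> sinv S x))
      = sinv S y \<cdot> ((sinv S x \<cdot> x) \<cdot> ((y \<cdot> sinv S y) \<cdot> sinv S x))"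
    using x y by (simp add: smult_assoc)
  also have "\<dots> = sinv S y \<cdot> ((y \<cdot> sinv S y) \<cdot> ((sinv S x \<cdot> x) \<cdot> sinv S x))"
    by (subst Idp_left_commute) (use x y in auto)
  also have "\<dots> = sinv S y \<cdot> sinv S x" using x y by (simp add: smult_assoc)
  finally show "sinv S y \<cdot> sinv S x \<cdot> (x \<cdot> y \<cdot> (sinv S y \<cdot> sinv S x)) = sinv S y \<cdot> sinv S x" .
qed (use x y in auto)

lemma szero_Idp [simp, intro]: "szero S \<in> Idp S"
  by (rule IdpI) auto

lemma sinv_szero_iff [simp]:
  assumes "x \<in> carrier S"
  shows "sinv S x = szero S \<longleftrightarrow> x = szero S"
  using assms sinv_sinv sinv_Idp szero_Idp by metis

lemma dom_idp_szero_iff: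
  assumes "x \<in> carrier S"
  shows "sinv S x \<cdot> x = szero S \<longleftrightarrow> x = szero S"
proof
  assume "sinv S x \<cdot> x = szero S"
  then have "x \<cdot> (sinv S x \<cdot> x) = szero S" using assms by (metis szero_right)
  then show "x = szero S" using assms by simp
qed (use assms in simp)

lemma Idp_conj [simp, intro]:
  assumes "e \<in> Idp S" "x \<in> carrier S"
  shows "sinv S x \<cdot> (e \<cdot> x) \<in> Idp S"
  using Idp_sinv_mult(1)[of "e \<cdot> x"] assms by (simp add: sinv_mult smult_assoc)

lemma restrict_dom_idp: "e \<in> Idp S \<Longrightarrow> x \<in> carrier S \<Longrightarrow> dom_idp S (x \<cdot> e) = dom_idp S x \<cdot> e"
  using Idp_commute[of e "sinv S x \<cdot> x"]
  by (simp add: dom_idp_def sinv_mult smult_assoc[symmetric])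
     (simp add: smult_assoc)

lemma nat_order_antisym:
  assumes "x \<in> carrier S" "y \<in> carrier S" "x = y \<cdot> dom_idp S x" "y = x \<cdot> dom_idp S y"
  shows "x = y"
proof -
  let ?d = "sinv S x \<cdot> x" and ?e = "sinv S y \<cdot> y"
  have "x = x \<cdot> ?e \<cdot> ?d" using assms by (metis dom_idp_def)
  also have "\<dots> = x \<cdot> (?e \<cdot> ?d)" using assms by (simp add: smult_assoc)
  also have "?e \<cdot> ?d = ?d \<cdot> ?e" by (rule Idp_commute) (use assms in auto)
  also have "x \<cdot> (?d \<cdot> ?e) = x \<cdot> ?e" using assms(1,2) by (simp add: smult_assoc)
  also have "\<dots> = y" using assms by (metis dom_idp_def)
  finally show ?thesis .
qed

lemma green_D_iff: "(x, y) \<in> green_D S \<longleftrightarrow> x \<in> carrier S \<and> y \<in> carrier S \<and>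
    (\<exists>w\<in>carrier S. sinv S x \<cdot> x = sinv S w \<cdot> w \<and> w \<cdot> sinv S w = y \<cdot> sinv S y)"
  by (auto simp: green_D_def green_L_def green_R_def dom_idp_def rng_idp_def)

text \<open>The product \<open>x w\<^sup>-\<^sup>1 y\<close> completes the square; this makes \<open>\<L> \<circ> \<R>\<close> symmetric and transitive.\<close>

lemma green_LR_commute:
  assumes x: "x \<in> carrier S" and w: "w \<in> carrier S" and y: "y \<in> carrier S"
    and d: "sinv S x \<cdot> x = sinv S w \<cdot> w" and r: "w \<cdot> sinv S w = y \<cdot> sinv S y"
  shows "\<exists>v\<in>carrier S. sinv S v \<cdot> v = sinv S y \<cdot> y \<and> v \<cdot> sinv S v = x \<cdot> sinv S x"
proof (intro bexI conjI)
  let ?v = "x \<cdot> (sinv S w \<cdot> y)"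
  have v': "sinv S ?v = sinv S y \<cdot> (w \<cdot> sinv S x)" using x y w by (simp add: sinv_mult smult_assoc)
  have "sinv S ?v \<cdot> ?v = sinv S y \<cdot> (w \<cdot> ((sinv S x \<cdot> x) \<cdot> (sinv S w \<cdot> y)))"
    using x y w by (simp add: v' smult_assoc)
  also have "\<dots> = sinv S y \<cdot> ((w \<cdot> sinv S w) \<cdot> y)" using x y w by (simp add: d smult_assoc)
  also have "\<dots> = sinv S y \<cdot> y" using x y w by (simp add: r smult_assoc)
  finally show "sinv S ?v \<cdot> ?v = sinv S y \<cdot> y" .
  have "?v \<cdot> sinv S ?v = x \<cdot> (sinv S w \<cdot> ((y \<cdot> sinv S y) \<cdot> (w \<cdot> sinv S x)))"
    using x y w by (simp add: v' smult_assoc)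
  also have "\<dots> = x \<cdot> ((sinv S w \<cdot> w) \<cdot> sinv S x)" using x y w by (simp add: r[symmetric] smult_assoc)
  also have "\<dots> = x \<cdot> sinv S x" using x y w by (simp add: d[symmetric] smult_assoc)
  finally show "?v \<cdot> sinv S ?v = x \<cdot> sinv S x" .
qed (use x y w in auto)

lemma equiv_green_D: "equiv (carrier S) (green_D S)"
proof (rule equivI)
  show "green_D S \<subseteq> carrier S \<times> carrier S" by (auto simp: green_D_iff)
  show "refl_on (carrier S) (green_D S)" by (auto simp: refl_on_def green_D_iff)
  show "sym (green_D S)"
  proof (rule symI)
    fix x y assume "(x, y) \<in> green_D S"
    then obtain w where "x \<in> carrier S" "y \<in> carrier S" "w \<in> carrier S"
      "sinv S x \<cdot> x = sinv S w \<cdot> w" "w \<cdot> sinv S w = y \<cdot> sinv S y"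
      by (auto simp: green_D_iff)
    then obtain v where "v \<in> carrier S" "sinv S v \<cdot> v = sinv S y \<cdot> y" "v \<cdot> sinv S v = x \<cdot> sinv S x"
      using green_LR_commute by blast
    then show "(y, x) \<in> green_D S"
      unfolding green_D_iff using \<open>x \<in> carrier S\<close> \<open>y \<in> carrier S\<close> by (intro conjI bexI[of _ v]) simp_all
  qed
  show "trans (green_D S)"
  proof (rule transI)
    fix x y z assume "(x, y) \<in> green_D S" "(y, z) \<in> green_D S"
    then obtain w v where *: "x \<in> carrier S" "y \<in> carrier S" "z \<in> carrier S" "w \<in> carrier S"
      "v \<in> carrier S" and d: "sinv S x \<cdot> x = sinv S w \<cdot> w" "sinv S y \<cdot> y = sinv S v \<cdot> v"
      and r: "w \<cdot> sinv S w = y \<cdot> sinv S y" "v \<cdot> sinv S v = z \<cdot> sinv S z"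
      unfolding green_D_iff by blast
    obtain u where "u \<in> carrier S" "sinv S u \<cdot> u = sinv S w \<cdot> w" "u \<cdot> sinv S u = v \<cdot> sinv S v"
      using green_LR_commute[of v y w] * d r by metis
    then show "(x, z) \<in> green_D S"
      unfolding green_D_iff using * d r by (intro conjI bexI[of _ u]) simp_all
  qed
qed

lemma green_D_dom_rng:
  assumes "x \<in> carrier S"
  shows "(x, dom_idp S x) \<in> green_D S" "(x, rng_idp S x) \<in> green_D S"
proof -
  show "(x, rng_idp S x) \<in> green_D S"
    using assms by (auto simp: green_D_iff rng_idp_def smult_assoc sinv_mult)
  have "(dom_idp S x, x) \<in> green_D S"
    using assms by (auto simp: green_D_iff dom_idp_def smult_assoc sinv_mult intro!: bexI[of _ x])
  then show "(x, dom_idp S x) \<in> green_D S"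
    using equiv_green_D by (meson equivE symD)
qed

lemma green_D_szero:
  "(x, szero S) \<in> green_D S \<longleftrightarrow> x = szero S" "(szero S, x) \<in> green_D S \<longleftrightarrow> x = szero S"
proof -
  have *: "x = szero S" if "(x, szero S) \<in> green_D S" for x
  proof -
    from that obtain w where "x \<in> carrier S" "w \<in> carrier S" "sinv S x \<cdot> x = sinv S w \<cdot> w"
      "w \<cdot> sinv S w = szero S"
      by (auto simp: green_D_iff)
    then have "w = szero S" using dom_idp_szero_iff[of "sinv S w"] by simp
    then show ?thesis using \<open>sinv S x \<cdot> x = sinv S w \<cdot> w\<close> \<open>x \<in> carrier S\<close> dom_idp_szero_iff by simp
  qed
  have r: "(szero S, szero S) \<in> green_D S" using equiv_green_D by (meson equivE refl_onD szero_closed)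
  show "(x, szero S) \<in> green_D S \<longleftrightarrow> x = szero S" using * r by auto
  show "(szero S, x) \<in> green_D S \<longleftrightarrow> x = szero S"
    using * r equiv_green_D by (metis equivE symD)
qed

text \<open>In the quotient, the classes of \<open>x\<^sup>-\<^sup>1\<close> and \<open>y\<^sup>-\<^sup>1\<close> are inverses of the same element.  The usual
  proof that inverses are unique when idempotents commute can then be carried out modulo \<open>\<theta>\<close>,
  first for \<open>d(x) \<equiv> d(y)\<close> and then for the inverses themselves.\<close>

lemma preserves_sinv:
  assumes eq: "equiv (carrier S) \<theta>" and mult: "preserves2 \<theta> (smult S)"
  shows "preserves1 \<theta> (sinv S)"
  unfolding preserves1_def
proof (clarify)
  fix x y assume xy: "(x, y) \<in> \<theta>"
  have [simp]: "x \<in> carrier S" "y \<in> carrier S" using xy eq by (auto simp: equiv_def)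
  have refl: "(a, a) \<in> \<theta>" if "a \<in> carrier S" for a using that eq by (auto simp: equiv_def refl_on_def)
  have sym: "(b, a) \<in> \<theta>" if "(a, b) \<in> \<theta>" for a b using that eq by (meson equivE symD)
  have trans: "(a, c) \<in> \<theta>" if "(a, b) \<in> \<theta>" "(b, c) \<in> \<theta>" for a b c
    using that eq by (meson equivE transD)
  have m: "(a \<cdot> b, a' \<cdot> b') \<in> \<theta>" if "(a, a') \<in> \<theta>" "(b, b') \<in> \<theta>" for a b a' b'
    using that mult by (auto simp: preserves2_def)
  let ?x = "sinv S x" and ?y = "sinv S y"
  have dom: "(?x \<cdot> x, ?y \<cdot> y) \<in> \<theta>"
  proof -
    have "?x \<cdot> y = ?x \<cdot> y \<cdot> (?y \<cdot> y)" by (simp add: smult_assoc)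
    moreover have "(?x \<cdot> y \<cdot> (?y \<cdot> y), ?x \<cdot> x \<cdot> (?y \<cdot> y)) \<in> \<theta>"
      by (intro m refl sym[OF xy]) simp_all
    moreover have "(?x \<cdot> x, ?x \<cdot> y) \<in> \<theta>" by (intro m refl xy) simp
    ultimately have 1: "(?x \<cdot> x, ?x \<cdot> x \<cdot> (?y \<cdot> y)) \<in> \<theta>" by (metis trans)
    have "?y \<cdot> x = ?y \<cdot> x \<cdot> (?x \<cdot> x)" by (simp add: smult_assoc)
    moreover have "(?y \<cdot> y \<cdot> (?x \<cdot> x), ?y \<cdot> x \<cdot> (?x \<cdot> x)) \<in> \<theta>"
      by (intro m refl sym[OF xy]) simp_all
    moreover have "(?y \<cdot> x, ?y \<cdot> y) \<in> \<theta>" by (intro m refl xy) simp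
    ultimately have "(?y \<cdot> y \<cdot> (?x \<cdot> x), ?y \<cdot> y) \<in> \<theta>" by (metis trans)
    moreover have "?x \<cdot> x \<cdot> (?y \<cdot> y) = ?y \<cdot> y \<cdot> (?x \<cdot> x)" by (rule Idp_commute) auto
    ultimately show ?thesis using 1 by (metis trans)
  qed
  have "(?x \<cdot> x \<cdot> ?x, ?y \<cdot> y \<cdot> ?x) \<in> \<theta>" by (intro m dom refl) simp
  moreover have "(?y \<cdot> y \<cdot> ?x, ?y \<cdot> x \<cdot> ?x) \<in> \<theta>" by (intro m refl sym[OF xy]) simp_all
  moreover have "(?y \<cdot> ((x \<cdot> ?x) \<cdot> (y \<cdot> ?y)), ?y \<cdot> ((x \<cdot> ?x) \<cdot> (x \<cdot> ?y))) \<in> \<theta>"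
    by (intro m refl sym[OF xy]) simp_all
  moreover have "?y \<cdot> x \<cdot> ?x = ?y \<cdot> ((x \<cdot> ?x) \<cdot> (y \<cdot> ?y))"
  proof -
    have "?y \<cdot> x \<cdot> ?x = ?y \<cdot> ((y \<cdot> ?y) \<cdot> (x \<cdot> ?x))" by (simp add: smult_assoc)
    also have "(y \<cdot> ?y) \<cdot> (x \<cdot> ?x) = (x \<cdot> ?x) \<cdot> (y \<cdot> ?y)" by (rule Idp_commute) auto
    finally show ?thesis .
  qed
  moreover have "(?y \<cdot> x \<cdot> ?y, ?y \<cdot> y \<cdot> ?y) \<in> \<theta>" by (intro m refl xy) simp_all
  ultimately show "(?x, ?y) \<in> \<theta>"
    by (simp add: smult_assoc) (meson trans)
qed

end

section \<open>Idempotents and agreement on orthogonal joins\<close>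

context boolean_inverse_semigroup
begin

abbreviation Idp_join (infixl \<open>\<curlyvee>\<close> 65) where
  "e \<curlyvee> f \<equiv> join (Idp_order S) e f"

abbreviation Idp_diff where
  "Idp_diff e f \<equiv> gba_diff (Idp_order S) e f"

interpretation L: generalized_boolean_algebra "Idp_order S"
  by (rule Idp_gba)

lemma carrier_Idp_order [simp]: "carrier (Idp_order S) = Idp S"
  by (simp add: Idp_order_def)

lemma Idp_le_iff:
  assumes "e \<in> Idp S"
  shows "le (Idp_order S) e f \<longleftrightarrow> e = f \<cdot> e"
  using assms by (simp add: Idp_order_def nat_order_def dom_idp_def)

lemma Idp_meet:
  assumes e: "e \<in> Idp S" and f: "f \<in> Idp S"
  shows "e \<sqinter>\<^bsub>Idp_order S\<^esub> f = e \<cdot> f"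
proof (rule L.le_antisym)
  have cl: "e \<sqinter>\<^bsub>Idp_order S\<^esub> f \<in> Idp S" using L.meet_closed[of e f] e f by simp
  have "e \<cdot> (e \<sqinter>\<^bsub>Idp_order S\<^esub> f) = e \<sqinter>\<^bsub>Idp_order S\<^esub> f" "f \<cdot> (e \<sqinter>\<^bsub>Idp_order S\<^esub> f) = e \<sqinter>\<^bsub>Idp_order S\<^esub> f"
    using L.meet_left[of e f] L.meet_right[of e f] cl e f by (simp_all add: Idp_le_iff)
  then show "le (Idp_order S) (e \<sqinter>\<^bsub>Idp_order S\<^esub> f) (e \<cdot> f)"
    using cl e f by (simp add: Idp_le_iff smult_assoc)
  have "f \<cdot> (e \<cdot> f) = e \<cdot> f" using e f by (simp add: Idp_left_commute[of f e])
  then show "le (Idp_order S) (e \<cdot> f) (e \<sqinter>\<^bsub>Idp_order S\<^esub> f)"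
    using e f by (intro L.meet_le) (simp_all add: Idp_le_iff)
  show "e \<sqinter>\<^bsub>Idp_order S\<^esub> f \<in> carrier (Idp_order S)" using cl by simp
qed (use e f in simp)

lemma Idp_bottom: "\<bottom>\<^bsub>Idp_order S\<^esub> = szero S"
proof -
  have "\<bottom>\<^bsub>Idp_order S\<^esub> \<in> Idp S" using L.bottom_closed by simp
  then show ?thesis
    using L.bottom_lower[of "szero S"] by (simp add: Idp_le_iff)
qed

lemma Idp_join_closed [simp, intro]: "e \<in> Idp S \<Longrightarrow> f \<in> Idp S \<Longrightarrow> e \<curlyvee> f \<in> Idp S"
  using L.join_closed[of e f] by simp

lemma Idp_join_upper:
  assumes "e \<in> Idp S" "f \<in> Idp S"
  shows "(e \<curlyvee> f) \<cdot> e = e" "(e \<curlyvee> f) \<cdot> f = f"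
  using L.join_left[of e f] L.join_right[of e f] assms by (simp_all add: Idp_le_iff)

lemma Idp_join_least:
  assumes "e \<in> Idp S" "f \<in> Idp S" "g \<in> Idp S" "g \<cdot> e = e" "g \<cdot> f = f"
  shows "g \<cdot> (e \<curlyvee> f) = e \<curlyvee> f"
  using L.join_le[of e g f] assms by (simp add: Idp_le_iff)

lemma Idp_mult_join:
  "e \<in> Idp S \<Longrightarrow> f \<in> Idp S \<Longrightarrow> g \<in> Idp S \<Longrightarrow> g \<cdot> (e \<curlyvee> f) = (g \<cdot> e) \<curlyvee> (g \<cdot> f)"
  using L.meet_join_distrib[of g e f] by (simp add: Idp_meet)

lemma Idp_join_szero [simp]:
  assumes "e \<in> Idp S"
  shows "szero S \<curlyvee> e = e"
  using Idp_join_least[of "szero S" e e] Idp_join_upper(2)[of "szero S" e]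
    Idp_commute[of e "szero S \<curlyvee> e"] assms
  by simp

lemma Idp_diff_props:
  assumes e: "e \<in> Idp S" and f: "f \<in> Idp S"
  shows "Idp_diff e f \<in> Idp S" "f \<cdot> Idp_diff e f = szero S" "(e \<cdot> f) \<curlyvee> Idp_diff e f = e"
    "e \<cdot> Idp_diff e f = Idp_diff e f"
proof -
  let ?P = "\<lambda>c. c \<in> Idp S \<and> e \<cdot> f \<cdot> c = szero S \<and> (e \<cdot> f) \<curlyvee> c = e"
  have P: "gba_diff (Idp_order S) e f = (THE c. ?P c)"
    unfolding gba_diff_def
    by (rule arg_cong[where f = The], rule ext)
      (use e f in \<open>auto simp: Idp_meet Idp_bottom\<close>)
  have "\<exists>c. ?P c"
    using L.sectionally_complemented[of e "e \<cdot> f"] e f by (auto simp: Idp_meet Idp_bottom Idp_le_iff)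
  moreover have "c = c \<cdot> d" if c: "?P c" and d: "?P d" for c d
  proof -
    have "c = c \<cdot> e" using c e f Idp_join_upper(2)[of "e \<cdot> f" c] Idp_commute[of e c] by simp
    also have "\<dots> = c \<cdot> ((e \<cdot> f) \<curlyvee> d)" using d by simp
    also have "\<dots> = (c \<cdot> (e \<cdot> f)) \<curlyvee> (c \<cdot> d)" using c d e f by (intro Idp_mult_join) auto
    also have "c \<cdot> (e \<cdot> f) = szero S" using c e f Idp_commute[of c "e \<cdot> f"] by simp
    also have "szero S \<curlyvee> (c \<cdot> d) = c \<cdot> d" using c d by simp
    finally show ?thesis .
  qed
  then have "c = d" if "?P c" "?P d" for c d
    using that Idp_commute[of c d] by metis
  ultimately have "\<exists>!c. ?P c" by blast
  then have D: "?P (Idp_diff e f)" unfolding P by (rule theI')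
  then show cl: "Idp_diff e f \<in> Idp S" and j: "(e \<cdot> f) \<curlyvee> Idp_diff e f = e" by auto
  show ed: "e \<cdot> Idp_diff e f = Idp_diff e f"
    using Idp_join_upper(2)[of "e \<cdot> f" "Idp_diff e f"] e f cl j by simp
  have "f \<cdot> Idp_diff e f = f \<cdot> (e \<cdot> Idp_diff e f)" using ed by simp
  also have "\<dots> = e \<cdot> f \<cdot> Idp_diff e f" using e f cl by (simp add: Idp_left_commute[of f e] smult_assoc)
  also have "\<dots> = szero S" using D by blast
  finally show "f \<cdot> Idp_diff e f = szero S" .
qed

lemma is_lub_nat_order_iff:
  assumes "x \<in> carrier S" "y \<in> carrier S"
  shows "is_lub (nat_order S) z {x, y} \<longleftrightarrow> z \<in> carrier S \<and> x = z \<cdot> dom_idp S x \<and> y = z \<cdot> dom_idp S y \<and>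
    (\<forall>w\<in>carrier S. x = w \<cdot> dom_idp S x \<and> y = w \<cdot> dom_idp S y \<longrightarrow> z = w \<cdot> dom_idp S z)"
  using assms by (auto simp: least_def Upper_def nat_order_def)

lemma dom_idp_Idp [simp]: "e \<in> Idp S \<Longrightarrow> dom_idp S e = e"
  by (simp add: dom_idp_def)

lemma dom_idp_closed [simp, intro]: "x \<in> carrier S \<Longrightarrow> dom_idp S x \<in> Idp S"
  by (simp add: dom_idp_def)

lemma mult_dom_idp [simp]: "x \<in> carrier S \<Longrightarrow> x \<cdot> dom_idp S x = x"
  by (simp add: dom_idp_def)

text \<open>The lattice join \<open>e \<curlyvee> f\<close> is only known to be least among idempotents.  But \<open>e\<close> and \<open>f\<close> also have
  a join \<open>z\<close> in \<open>S\<close>; as \<open>z \<le> e \<curlyvee> f\<close>, it is idempotent and therefore equal to \<open>e \<curlyvee> f\<close>.  The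
  conditions on \<open>t\<close> say that \<open>t\<close> is an upper bound of \<open>e\<close> and \<open>f\<close> in \<open>S\<close>.\<close>

lemma Idp_join_le_of_fixed:
  assumes e: "e \<in> Idp S" and f: "f \<in> Idp S" and ef: "e \<cdot> f = szero S"
    and t: "t \<in> carrier S" "t \<cdot> e = e" "t \<cdot> f = f"
  shows "t \<cdot> (e \<curlyvee> f) = e \<curlyvee> f"
proof -
  let ?h = "e \<curlyvee> f"
  have "orthogonal S e f" using e f ef by (simp add: orthogonal_def)
  then obtain z where lub: "is_lub (nat_order S) z {e, f}" 
    using orthogonal_join IdpD(1)[OF e] IdpD(1)[OF f] by blast
  then have z: "z \<in> carrier S" "e = z \<cdot> e" "f = z \<cdot> f"
    and least: "\<And>w. w \<in> carrier S \<Longrightarrow> e = w \<cdot> e \<Longrightarrow> f = w \<cdot> f \<Longrightarrow> z = w \<cdot> dom_idp S z"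
    using e f by (auto simp: is_lub_nat_order_iff)
  have h: "z = ?h \<cdot> dom_idp S z" using e f by (intro least) (simp_all add: Idp_join_upper)
  then have zI: "z \<in> Idp S" using z e f by (metis Idp_join_closed Idp_mult dom_idp_closed)
  then have "z \<cdot> ?h = ?h" using z e f by (intro Idp_join_least) auto
  moreover have "?h \<cdot> z = z" using h zI by simp
  ultimately have "z = ?h" using Idp_commute[of z ?h] zI e f by simp
  moreover have "z = t \<cdot> dom_idp S z" using t by (intro least) auto
  ultimately show ?thesis using zI by simp
qed

text \<open>The element \<open>x\<^sup>-\<^sup>1 y\<close> fixes \<open>d(x) e\<close> and \<open>d(x) f\<close>, hence it fixes their join \<open>d(x) (e \<curlyvee> f)\<close>.
  Multiplying by \<open>x\<close> on the left gives \<open>x (e \<curlyvee> f) = r(x) y (e \<curlyvee> f)\<close>, and the symmetric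
  equation removes the factor \<open>r(x)\<close>.\<close>

lemma agree_on_join:
  assumes x: "x \<in> carrier S" and y: "y \<in> carrier S"
    and e: "e \<in> Idp S" and f: "f \<in> Idp S" and ef: "e \<cdot> f = szero S"
    and xe: "x \<cdot> e = y \<cdot> e" and xf: "x \<cdot> f = y \<cdot> f"
  shows "x \<cdot> (e \<curlyvee> f) = y \<cdot> (e \<curlyvee> f)"
proof -
  let ?h = "e \<curlyvee> f"
  have le: "x \<cdot> ?h = x \<cdot> sinv S x \<cdot> (y \<cdot> (dom_idp S x \<cdot> ?h))"
    if x: "x \<in> carrier S" and y: "y \<in> carrier S" and xe: "x \<cdot> e = y \<cdot> e" and xf: "x \<cdot> f = y \<cdot> f" for x y
  proof -
    let ?d = "dom_idp S x"
    have d: "?d \<in> Idp S" using x by simp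
    have fixed: "sinv S x \<cdot> y \<cdot> (?d \<cdot> g) = ?d \<cdot> g" if g: "g \<in> Idp S" "x \<cdot> g = y \<cdot> g" for g
    proof -
      have "y \<cdot> (?d \<cdot> g) = y \<cdot> g \<cdot> ?d" using y d g by (simp add: Idp_commute[of ?d g] smult_assoc)
      also have "\<dots> = x \<cdot> (?d \<cdot> g)" using x d g(1) by (simp add: Idp_commute[of ?d g] smult_assoc flip: g(2))
      also have "\<dots> = x \<cdot> g" using x d g(1) by (simp add: dom_idp_def smult_assoc)
      finally show ?thesis using x y d g(1) by (simp add: dom_idp_def smult_assoc)
    qed
    have "?d \<cdot> e \<cdot> (?d \<cdot> f) = ?d \<cdot> (e \<cdot> f)"
      using d e f by (simp add: smult_assoc Idp_left_commute[of e ?d])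
    then have "?d \<cdot> e \<cdot> (?d \<cdot> f) = szero S" using ef d by simp
    then have "sinv S x \<cdot> y \<cdot> ((?d \<cdot> e) \<curlyvee> (?d \<cdot> f)) = (?d \<cdot> e) \<curlyvee> (?d \<cdot> f)"
      using x y d e f xe xf by (intro Idp_join_le_of_fixed fixed) auto
    then have t: "sinv S x \<cdot> y \<cdot> (?d \<cdot> ?h) = ?d \<cdot> ?h"
      using d e f by (simp add: Idp_mult_join)
    have "x \<cdot> ?h = x \<cdot> (?d \<cdot> ?h)" using x d e f by (simp add: dom_idp_def smult_assoc)
    also have "\<dots> = x \<cdot> (sinv S x \<cdot> y \<cdot> (?d \<cdot> ?h))" by (simp only: t)
    finally show ?thesis using x y d e f by (simp add: smult_assoc)
  qed
  have "dom_idp S x \<cdot> e = dom_idp S y \<cdot> e" "dom_idp S x \<cdot> f = dom_idp S y \<cdot> f"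
    using restrict_dom_idp[of e x] restrict_dom_idp[of e y] restrict_dom_idp[of f x]
      restrict_dom_idp[of f y] x y e f xe xf by simp_all
  then have d: "dom_idp S x \<cdot> ?h = dom_idp S y \<cdot> ?h"
    using x y e f by (simp add: Idp_mult_join)
  have dom: "z \<cdot> (dom_idp S z \<cdot> ?h) = z \<cdot> ?h" if "z \<in> carrier S" for z
    using that e f by (simp add: dom_idp_def smult_assoc)
  have xh: "x \<cdot> ?h = x \<cdot> sinv S x \<cdot> (y \<cdot> ?h)" using le[OF x y xe xf] dom[OF y] d by simp
  have yh: "y \<cdot> ?h = y \<cdot> sinv S y \<cdot> (x \<cdot> ?h)"
    using le[OF y x xe[symmetric] xf[symmetric]] dom[OF x] d by simp
  have "x \<cdot> ?h = x \<cdot> sinv S x \<cdot> (y \<cdot> sinv S y \<cdot> (x \<cdot> ?h))" using xh yh by simp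
  also have "\<dots> = y \<cdot> sinv S y \<cdot> (x \<cdot> sinv S x \<cdot> (x \<cdot> ?h))"
    by (rule Idp_left_commute) (use x y e f in auto)
  also have "x \<cdot> sinv S x \<cdot> (x \<cdot> ?h) = x \<cdot> ?h" using x e f by (simp add: smult_assoc)
  finally show ?thesis using yh by simp
qed

text \<open>With \<open>osum_unique\<close> below, these equations characterize \<open>x \<oplus> y\<close> without the natural
  ordering: it restricts to \<open>x\<close> and \<open>y\<close>, and its domain is no larger than necessary.\<close>

lemma osum_props:
  assumes x: "x \<in> carrier S" and y: "y \<in> carrier S" and xy: "orthogonal S x y"
  shows "osum S x y \<in> carrier S" "osum S x y \<cdot> dom_idp S x = x" "osum S x y \<cdot> dom_idp S y = y"
    "osum S x y \<cdot> (dom_idp S x \<curlyvee> dom_idp S y) = osum S x y"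
proof -
  let ?z = "osum S x y" and ?h = "dom_idp S x \<curlyvee> dom_idp S y"
  have "is_lub (nat_order S) ?z {x, y}"
    unfolding osum_def join_def Lattice.sup_def using orthogonal_join[OF x y xy] by (rule someI_ex)
  then have z: "?z \<in> carrier S" "x = ?z \<cdot> dom_idp S x" "y = ?z \<cdot> dom_idp S y"
    and least: "\<And>w. w \<in> carrier S \<Longrightarrow> x = w \<cdot> dom_idp S x \<Longrightarrow> y = w \<cdot> dom_idp S y \<Longrightarrow>
      ?z = w \<cdot> dom_idp S ?z"
    using x y by (auto simp: is_lub_nat_order_iff)
  show "?z \<in> carrier S" "?z \<cdot> dom_idp S x = x" "?z \<cdot> dom_idp S y = y" using z by simp_all
  have "x = ?z \<cdot> ?h \<cdot> dom_idp S x" "y = ?z \<cdot> ?h \<cdot> dom_idp S y"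
    using x y z by (simp_all add: smult_assoc Idp_join_upper)
  then have "?z = ?z \<cdot> ?h \<cdot> dom_idp S ?z"
    using x y z(1) by (intro least) auto
  also have "\<dots> = ?z \<cdot> (dom_idp S ?z \<cdot> ?h)"
    using x y z(1) by (simp add: smult_assoc Idp_commute[of ?h])
  also have "\<dots> = ?z \<cdot> ?h" using x y z(1) by (simp flip: smult_assoc)
  finally show "?z \<cdot> ?h = ?z" ..
qed

lemma orthogonal_dom_idp:
  assumes x: "x \<in> carrier S" and y: "y \<in> carrier S" and xy: "orthogonal S x y"
  shows "dom_idp S x \<cdot> dom_idp S y = szero S"
proof -
  have "dom_idp S x \<cdot> dom_idp S y = sinv S x \<cdot> (x \<cdot> sinv S y) \<cdot> y"
    using x y by (simp add: dom_idp_def smult_assoc)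
  then show ?thesis using x y xy by (simp add: orthogonal_def)
qed

lemma osum_unique:
  assumes x: "x \<in> carrier S" and y: "y \<in> carrier S" and xy: "orthogonal S x y"
    and z: "z \<in> carrier S" "z \<cdot> dom_idp S x = x" "z \<cdot> dom_idp S y = y"
      "z \<cdot> (dom_idp S x \<curlyvee> dom_idp S y) = z"
  shows "osum S x y = z"
  using agree_on_join[of "osum S x y" z "dom_idp S x" "dom_idp S y"]
    osum_props[OF x y xy] orthogonal_dom_idp[OF x y xy] x y z
  by simp

section \<open>The bias congruence of an additive ideal\<close>

text \<open>Closure under \<open>e \<mapsto> t\<^sup>-\<^sup>1 e t\<close> contains closure under smaller idempotents, as one sees by
  taking \<open>t\<close> idempotent.\<close>

definition additive_ideal :: "'a set \<Rightarrow> bool" where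
  "additive_ideal I \<longleftrightarrow> I \<subseteq> Idp S \<and> szero S \<in> I \<and> (\<forall>e\<in>I. \<forall>f\<in>I. e \<curlyvee> f \<in> I) \<and>
     (\<forall>e\<in>I. \<forall>t\<in>carrier S. sinv S t \<cdot> (e \<cdot> t) \<in> I)"

text \<open>Agreement off \<open>e\<close> is tested on every idempotent orthogonal to \<open>e\<close>, because a semigroup without
  a unit has no complement of \<open>e\<close> to multiply with.\<close>

definition ideal_cong :: "'a set \<Rightarrow> ('a \<times> 'a) set" where
  "ideal_cong I = {(x, y). x \<in> carrier S \<and> y \<in> carrier S \<and>
     (\<exists>e\<in>I. \<forall>f\<in>Idp S. f \<cdot> e = szero S \<longrightarrow> x \<cdot> f = y \<cdot> f)}"

lemma ideal_congI:
  assumes "x \<in> carrier S" "y \<in> carrier S" "e \<in> I"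
    and "\<And>f. f \<in> Idp S \<Longrightarrow> f \<cdot> e = szero S \<Longrightarrow> x \<cdot> f = y \<cdot> f"
  shows "(x, y) \<in> ideal_cong I"
  using assms unfolding ideal_cong_def by blast

lemma ideal_cong_common_witness:
  assumes I: "additive_ideal I" and xy: "(x, y) \<in> ideal_cong I" and uv: "(u, v) \<in> ideal_cong I"
  obtains e where "e \<in> I"
    "\<And>f. f \<in> Idp S \<Longrightarrow> f \<cdot> e = szero S \<Longrightarrow> x \<cdot> f = y \<cdot> f \<and> u \<cdot> f = v \<cdot> f"
proof -
  obtain e1 where e1: "e1 \<in> I" "\<And>f. f \<in> Idp S \<Longrightarrow> f \<cdot> e1 = szero S \<Longrightarrow> x \<cdot> f = y \<cdot> f"
    using xy by (auto simp: ideal_cong_def)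
  obtain e2 where e2: "e2 \<in> I" "\<And>f. f \<in> Idp S \<Longrightarrow> f \<cdot> e2 = szero S \<Longrightarrow> u \<cdot> f = v \<cdot> f"
    using uv by (auto simp: ideal_cong_def)
  have idp: "e1 \<in> Idp S" "e2 \<in> Idp S" and I12: "e1 \<curlyvee> e2 \<in> I"
    using I e1(1) e2(1) by (auto simp: additive_ideal_def)
  have "f \<cdot> e1 = szero S \<and> f \<cdot> e2 = szero S"
    if f: "f \<in> Idp S" "f \<cdot> (e1 \<curlyvee> e2) = szero S" for f
  proof -
    have "f \<cdot> e1 = f \<cdot> (e1 \<curlyvee> e2) \<cdot> e1" "f \<cdot> e2 = f \<cdot> (e1 \<curlyvee> e2) \<cdot> e2"
      using f(1) idp by (simp_all add: smult_assoc Idp_join_upper)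
    then show ?thesis using f idp by simp
  qed
  then show thesis using e1 e2 I12 by (intro that[of "e1 \<curlyvee> e2"]) auto
qed

lemma equiv_ideal_cong:
  assumes I: "additive_ideal I"
  shows "equiv (carrier S) (ideal_cong I)"
proof (rule equivI)
  show "ideal_cong I \<subseteq> carrier S \<times> carrier S" by (auto simp: ideal_cong_def)
  have "szero S \<in> I" using I by (simp add: additive_ideal_def)
  then show "refl_on (carrier S) (ideal_cong I)" by (auto simp: refl_on_def intro: ideal_congI)
  show "sym (ideal_cong I)" by (rule symI) (simp add: ideal_cong_def, metis)
  show "trans (ideal_cong I)"
  proof (rule transI)
    fix x y z assume xy: "(x, y) \<in> ideal_cong I" and yz: "(y, z) \<in> ideal_cong I"
    obtain e where "e \<in> I" "\<And>f. f \<in> Idp S \<Longrightarrow> f \<cdot> e = szero S \<Longrightarrow> x \<cdot> f = y \<cdot> f \<and> y \<cdot> f = z \<cdot> f"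
      using ideal_cong_common_witness[OF I xy yz] by blast
    then show "(x, z) \<in> ideal_cong I"
      using xy yz by (intro ideal_congI[of _ _ e]) (auto simp: ideal_cong_def)
  qed
qed

lemma ideal_cong_smult_left:
  assumes xy: "(x, y) \<in> ideal_cong I" and t: "t \<in> carrier S" and I: "I \<subseteq> Idp S"
  shows "(t \<cdot> x, t \<cdot> y) \<in> ideal_cong I"
proof -
  obtain e where e: "e \<in> I" "\<And>f. f \<in> Idp S \<Longrightarrow> f \<cdot> e = szero S \<Longrightarrow> x \<cdot> f = y \<cdot> f"
    and x: "x \<in> carrier S" "y \<in> carrier S"
    using xy by (auto simp: ideal_cong_def)
  show ?thesis
    by (rule ideal_congI[of _ _ e]) (use e x t in \<open>simp_all add: smult_assoc\<close>)
qed

text \<open>If \<open>f\<close> is orthogonal to \<open>t\<^sup>-\<^sup>1 e t\<close>, then \<open>g = t f t\<^sup>-\<^sup>1\<close> is orthogonal to \<open>e\<close> and satisfies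
  \<open>g t = t f\<close>; so agreement of \<open>x\<close> and \<open>y\<close> on \<open>g\<close> is agreement of \<open>x t\<close> and \<open>y t\<close> on \<open>f\<close>.\<close>

lemma ideal_cong_smult_right:
  assumes I: "additive_ideal I" and xy: "(x, y) \<in> ideal_cong I" and t: "t \<in> carrier S"
  shows "(x \<cdot> t, y \<cdot> t) \<in> ideal_cong I"
proof -
  obtain e where e: "e \<in> I" "\<And>f. f \<in> Idp S \<Longrightarrow> f \<cdot> e = szero S \<Longrightarrow> x \<cdot> f = y \<cdot> f"
    and x: "x \<in> carrier S" "y \<in> carrier S"
    using xy by (auto simp: ideal_cong_def)
  have eI: "e \<in> Idp S" using I e(1) by (auto simp: additive_ideal_def)
  show ?thesis
  proof (rule ideal_congI[of _ _ "sinv S t \<cdot> (e \<cdot> t)"])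
    fix f assume f: "f \<in> Idp S" and fe: "f \<cdot> (sinv S t \<cdot> (e \<cdot> t)) = szero S"
    let ?g = "t \<cdot> (f \<cdot> sinv S t)"
    have g: "?g \<in> Idp S" using Idp_conj[of f "sinv S t"] f t by simp
    have "?g \<cdot> e = ?g \<cdot> (t \<cdot> sinv S t) \<cdot> e" using f t eI by (simp add: smult_assoc)
    also have "\<dots> = ?g \<cdot> (e \<cdot> (t \<cdot> sinv S t))"
      using g eI t Idp_commute[of e "t \<cdot> sinv S t"] by (simp add: smult_assoc)
    also have "\<dots> = t \<cdot> (f \<cdot> (sinv S t \<cdot> (e \<cdot> t)) \<cdot> sinv S t)"
      using f t eI by (simp add: smult_assoc)
    also have "\<dots> = szero S" using fe t by simp
    finally have "x \<cdot> ?g = y \<cdot> ?g" using e(2) g by blast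
    then have "x \<cdot> ?g \<cdot> t = y \<cdot> ?g \<cdot> t" by simp
    moreover have "?g \<cdot> t = t \<cdot> f"
    proof -
      have "?g \<cdot> t = t \<cdot> (f \<cdot> (sinv S t \<cdot> t))" using f t by (simp add: smult_assoc)
      also have "f \<cdot> (sinv S t \<cdot> t) = sinv S t \<cdot> t \<cdot> f" by (rule Idp_commute) (use f t in auto)
      finally show ?thesis using f t by (simp add: smult_assoc)
    qed
    ultimately show "x \<cdot> t \<cdot> f = y \<cdot> t \<cdot> f"
      using x t f g by (simp add: smult_assoc del: mult_sinv_mult mult_sinv_mult_assoc)
  next
    show "sinv S t \<cdot> (e \<cdot> t) \<in> I" using I e(1) t by (auto simp: additive_ideal_def)
  qed (use x t in auto)
qed

text \<open>The part of \<open>(e - f) j\<close> below \<open>e' f'\<close> vanishes because \<open>f' j = f j\<close> is orthogonal to \<open>e - f\<close>; what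
  remains lies below \<open>e' - f'\<close>.\<close>

lemma Idp_diff_local:
  assumes e: "e \<in> Idp S" "e' \<in> Idp S" and f: "f \<in> Idp S" "f' \<in> Idp S" and j: "j \<in> Idp S"
    and ej: "e \<cdot> j = e' \<cdot> j" and fj: "f \<cdot> j = f' \<cdot> j"
  shows "Idp_diff e f \<cdot> j = Idp_diff e' f' \<cdot> j"
proof -
  have half: "Idp_diff e f \<cdot> j = Idp_diff e f \<cdot> Idp_diff e' f' \<cdot> j"
    if e: "e \<in> Idp S" "e' \<in> Idp S" and f: "f \<in> Idp S" "f' \<in> Idp S"
      and ej: "e \<cdot> j = e' \<cdot> j" and fj: "f \<cdot> j = f' \<cdot> j" for e f e' f'
  proof -
    let ?g = "Idp_diff e f" and ?g' = "Idp_diff e' f'"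
    note g = Idp_diff_props[OF e(1) f(1)] and g' = Idp_diff_props[OF e(2) f(2)]
    have "?g \<cdot> j = ?g \<cdot> (e \<cdot> j)"
      using g(1,4) e j Idp_commute[of e ?g] by (simp flip: smult_assoc)
    also have "\<dots> = ?g \<cdot> j \<cdot> e'"
      using g(1) e j Idp_commute[of e' j] by (simp add: ej smult_assoc)
    also have "\<dots> = ?g \<cdot> j \<cdot> ((e' \<cdot> f') \<curlyvee> ?g')" by (simp only: g'(3))
    also have "\<dots> = (?g \<cdot> j \<cdot> (e' \<cdot> f')) \<curlyvee> (?g \<cdot> j \<cdot> ?g')"
      using g(1) g'(1) e f j by (intro Idp_mult_join) auto
    also have "?g \<cdot> j \<cdot> (e' \<cdot> f') = ?g \<cdot> (e' \<cdot> (f' \<cdot> j))"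
      using g(1) e f j Idp_commute[of j "e' \<cdot> f'"] by (simp add: smult_assoc)
    also have "\<dots> = e' \<cdot> (f \<cdot> ?g \<cdot> j)"
      using g(1) e f j Idp_commute[of f ?g] by (simp add: Idp_left_commute[of ?g e'] smult_assoc flip: fj)
    also have "\<dots> = szero S" using g(2) e j by simp
    also have "szero S \<curlyvee> (?g \<cdot> j \<cdot> ?g') = ?g \<cdot> j \<cdot> ?g'" using g(1) g'(1) j by simp
    also have "\<dots> = ?g \<cdot> ?g' \<cdot> j" using g(1) g'(1) j Idp_commute[of j ?g'] by (simp add: smult_assoc)
    finally show ?thesis .
  qed
  have "Idp_diff e f \<cdot> Idp_diff e' f' = Idp_diff e' f' \<cdot> Idp_diff e f"
    using Idp_diff_props(1) e f by (intro Idp_commute) auto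
  then show ?thesis using half[OF e f ej fj] half[of e' e f' f] e f ej fj by simp
qed

lemma skew_diff_props:
  assumes x: "x \<in> carrier S" and y: "y \<in> carrier S"
  shows "skew_diff S x y \<in> carrier S" "orthogonal S (skew_diff S x y) y"
proof -
  let ?r = "Idp_diff (rng_idp S x) (rng_idp S y)" and ?d = "Idp_diff (dom_idp S x) (dom_idp S y)"
  have r: "rng_idp S x \<in> Idp S" "rng_idp S y \<in> Idp S" using x y by (auto simp: rng_idp_def)
  have d: "dom_idp S x \<in> Idp S" "dom_idp S y \<in> Idp S" using x y by auto
  note R = Idp_diff_props[OF r] and D = Idp_diff_props[OF d]
  show cl: "skew_diff S x y \<in> carrier S" using x R(1) D(1) by (simp add: skew_diff_def)
  have "?r \<cdot> y = ?r \<cdot> (rng_idp S y \<cdot> y)" using y by (simp add: rng_idp_def smult_assoc)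
  also have "\<dots> = rng_idp S y \<cdot> ?r \<cdot> y"
    using R(1) r y by (simp add: Idp_commute[of _ ?r] smult_assoc)
  also have "\<dots> = szero S" using R(2) y by simp
  finally have ry: "?r \<cdot> y = szero S" .
  have "?d \<cdot> sinv S y = ?d \<cdot> (dom_idp S y \<cdot> sinv S y)" using y by (simp add: dom_idp_def smult_assoc)
  also have "\<dots> = dom_idp S y \<cdot> ?d \<cdot> sinv S y"
    using D(1) d y by (simp add: Idp_commute[of _ ?d] smult_assoc)
  also have "\<dots> = szero S" using D(2) y by simp
  finally have dy: "?d \<cdot> sinv S y = szero S" .
  have "sinv S (skew_diff S x y) \<cdot> y = ?d \<cdot> (sinv S x \<cdot> (?r \<cdot> y))"
    using x y R(1) D(1) by (simp add: skew_diff_def sinv_mult smult_assoc)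
  moreover have "skew_diff S x y \<cdot> sinv S y = ?r \<cdot> (x \<cdot> (?d \<cdot> sinv S y))"
    using x y R(1) D(1) by (simp add: skew_diff_def smult_assoc)
  ultimately show "orthogonal S (skew_diff S x y) y"
    using x R(1) D(1) by (simp add: orthogonal_def ry dy)
qed

text \<open>Products are compatible by the two lemmas on multiplication, hence so are inverses, domains
  and ranges.  For differences and joins a common witness \<open>i\<close> reduces the claim to an equation on
  each idempotent \<open>j\<close> orthogonal to \<open>i\<close>, where \<open>Idp_diff_local\<close> and \<open>agree_on_join\<close> apply.\<close>

lemma bias_congruence_ideal_cong:
  assumes I: "additive_ideal I"
  shows "bias_congruence S (ideal_cong I)"
proof -
  let ?\<theta> = "ideal_cong I"
  note eq = equiv_ideal_cong[OF I]
  have cl: "x \<in> carrier S \<and> y \<in> carrier S" if "(x, y) \<in> ?\<theta>" for x y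
    using that by (simp add: ideal_cong_def)
  have sym: "(y, x) \<in> ?\<theta>" if "(x, y) \<in> ?\<theta>" for x y using that eq by (meson equivE symD)
  have trans: "(x, z) \<in> ?\<theta>" if "(x, y) \<in> ?\<theta>" "(y, z) \<in> ?\<theta>" for x y z
    using that eq by (meson equivE transD)
  have refl: "(x, x) \<in> ?\<theta>" if "x \<in> carrier S" for x
    using that eq by (meson equivE refl_onD)
  have mult: "(x \<cdot> y, x' \<cdot> y') \<in> ?\<theta>" if "(x, x') \<in> ?\<theta>" "(y, y') \<in> ?\<theta>" for x x' y y'
    using ideal_cong_smult_left[OF that(2), of x] ideal_cong_smult_right[OF I that(1), of y']
      cl[OF that(1)] cl[OF that(2)] I trans
    by (auto simp: additive_ideal_def)
  then have mult': "preserves2 ?\<theta> (smult S)" by (auto simp: preserves2_def)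
  then have sinv': "preserves1 ?\<theta> (sinv S)" by (rule preserves_sinv[OF eq])
  then have sinv: "(sinv S x, sinv S y) \<in> ?\<theta>" if "(x, y) \<in> ?\<theta>" for x y
    using that by (auto simp: preserves1_def)
  have dom: "(dom_idp S x, dom_idp S y) \<in> ?\<theta>" and rng: "(rng_idp S x, rng_idp S y) \<in> ?\<theta>"
    if "(x, y) \<in> ?\<theta>" for x y
    using that by (auto simp: dom_idp_def rng_idp_def intro: mult sinv)
  have diff: "(Idp_diff e f, Idp_diff e' f') \<in> ?\<theta>"
    if e: "(e, e') \<in> ?\<theta>" "e \<in> Idp S" "e' \<in> Idp S" and f: "(f, f') \<in> ?\<theta>" "f \<in> Idp S" "f' \<in> Idp S"
    for e e' f f'
  proof -
    obtain i where i: "i \<in> I"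
      "\<And>j. j \<in> Idp S \<Longrightarrow> j \<cdot> i = szero S \<Longrightarrow> e \<cdot> j = e' \<cdot> j \<and> f \<cdot> j = f' \<cdot> j"
      using ideal_cong_common_witness[OF I e(1) f(1)] by blast
    show ?thesis
    proof (rule ideal_congI[OF _ _ i(1)])
      show "Idp_diff e f \<in> carrier S" "Idp_diff e' f' \<in> carrier S"
        using Idp_diff_props(1) e f by simp_all
      fix j assume "j \<in> Idp S" "j \<cdot> i = szero S"
      then show "Idp_diff e f \<cdot> j = Idp_diff e' f' \<cdot> j"
        using i(2)[of j] e f by (intro Idp_diff_local) blast+
    qed
  qed
  have skew: "(skew_diff S x y, skew_diff S x' y') \<in> ?\<theta>" if x: "(x, x') \<in> ?\<theta>" and y: "(y, y') \<in> ?\<theta>"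
    for x x' y y'
    unfolding skew_diff_def
    by (intro mult diff dom rng x y) (use cl[OF x] cl[OF y] in \<open>auto simp: rng_idp_def\<close>)
  \<comment> \<open>Modulo the congruence the first sum is a restriction of the second: the two agree on
    \<open>d(u)\<close>, since \<open>u \<equiv> u'\<close> and \<open>d(u) \<equiv> d(u')\<close>, and likewise on \<open>d(y)\<close>.\<close>
  have half: "(osum S u y, osum S u' y' \<cdot> (dom_idp S u \<curlyvee> dom_idp S y)) \<in> ?\<theta>"
    if u: "(u, u') \<in> ?\<theta>" and y: "(y, y') \<in> ?\<theta>" and o: "orthogonal S u y" "orthogonal S u' y'"
    for u u' y y'
  proof -
    let ?z = "osum S u y" and ?z' = "osum S u' y'"
    have c: "u \<in> carrier S" "u' \<in> carrier S" "y \<in> carrier S" "y' \<in> carrier S"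
      using cl[OF u] cl[OF y] by auto
    note z = osum_props[OF c(1,3) o(1)] and z' = osum_props[OF c(2,4) o(2)]
    have 1: "(?z \<cdot> dom_idp S u, ?z' \<cdot> dom_idp S u) \<in> ?\<theta>"
      using trans[OF u] mult[OF refl[OF z'(1)] dom[OF sym[OF u]]] z(2) z'(2) by simp
    have 2: "(?z \<cdot> dom_idp S y, ?z' \<cdot> dom_idp S y) \<in> ?\<theta>"
      using trans[OF y] mult[OF refl[OF z'(1)] dom[OF sym[OF y]]] z(3) z'(3) by simp
    obtain i where i: "i \<in> I" and ag: "\<And>j. j \<in> Idp S \<Longrightarrow> j \<cdot> i = szero S \<Longrightarrow>
        ?z \<cdot> dom_idp S u \<cdot> j = ?z' \<cdot> dom_idp S u \<cdot> j \<and> ?z \<cdot> dom_idp S y \<cdot> j = ?z' \<cdot> dom_idp S y \<cdot> j"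
      using ideal_cong_common_witness[OF I 1 2] by blast
    have "(?z \<cdot> (dom_idp S u \<curlyvee> dom_idp S y), ?z' \<cdot> (dom_idp S u \<curlyvee> dom_idp S y)) \<in> ?\<theta>"
    proof (rule ideal_congI[OF _ _ i])
      fix j assume j: "j \<in> Idp S" "j \<cdot> i = szero S"
      have comm: "w \<cdot> g \<cdot> j = w \<cdot> j \<cdot> g" if "w \<in> carrier S" "g \<in> Idp S" for w g
        using that j Idp_commute[of g j] by (simp add: smult_assoc)
      have "?z \<cdot> j \<cdot> (dom_idp S u \<curlyvee> dom_idp S y) = ?z' \<cdot> j \<cdot> (dom_idp S u \<curlyvee> dom_idp S y)"
        using ag[OF j] z(1) z'(1) c j orthogonal_dom_idp[OF c(1,3) o(1)]
        by (intro agree_on_join) (auto simp: comm)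
      then show "?z \<cdot> (dom_idp S u \<curlyvee> dom_idp S y) \<cdot> j = ?z' \<cdot> (dom_idp S u \<curlyvee> dom_idp S y) \<cdot> j"
        using z(1) z'(1) c by (simp add: comm)
    qed (use z z' c in auto)
    then show ?thesis using z(4) by simp
  qed
  \<comment> \<open>Two sums that are restrictions of each other are congruent, as in the proof that the natural
    ordering is antisymmetric.\<close>
  have join: "(osum S u y, osum S u' y') \<in> ?\<theta>"
    if u: "(u, u') \<in> ?\<theta>" and y: "(y, y') \<in> ?\<theta>" and o: "orthogonal S u y" "orthogonal S u' y'"
    for u u' y y'
  proof -
    let ?z = "osum S u y" and ?z' = "osum S u' y'"
    let ?h = "dom_idp S u \<curlyvee> dom_idp S y" and ?h' = "dom_idp S u' \<curlyvee> dom_idp S y'"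
    have c: "u \<in> carrier S" "u' \<in> carrier S" "y \<in> carrier S" "y' \<in> carrier S"
      using cl[OF u] cl[OF y] by auto
    note z = osum_props[OF c(1,3) o(1)] and z' = osum_props[OF c(2,4) o(2)]
    have h: "?h \<in> Idp S" "?h' \<in> Idp S" using c by auto
    have z'z: "(?z', ?z \<cdot> ?h') \<in> ?\<theta>" using half[OF sym[OF u] sym[OF y] o(2,1)] .
    have "(?z' \<cdot> ?h, ?z \<cdot> ?h' \<cdot> ?h) \<in> ?\<theta>" using mult[OF z'z refl] h by simp
    also have "?z \<cdot> ?h' \<cdot> ?h = ?z \<cdot> ?h \<cdot> ?h'"
      using z(1) h Idp_commute[of ?h ?h'] by (simp add: smult_assoc)
    finally have "(?z' \<cdot> ?h, ?z \<cdot> ?h') \<in> ?\<theta>" using z(4) by simp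
    then show ?thesis using half[OF u y o] z'z sym trans by blast
  qed
  have "(skew_add S x y, skew_add S x' y') \<in> ?\<theta>" if x: "(x, x') \<in> ?\<theta>" and y: "(y, y') \<in> ?\<theta>"
    for x x' y y'
    unfolding skew_add_def
    by (intro join skew x y skew_diff_props) (use cl[OF x] cl[OF y] in auto)
  then show ?thesis
    using eq mult' sinv' skew by (auto simp: bias_congruence_def preserves2_def)
qed

lemma ideal_cong_nontrivial:
  assumes e: "e \<in> I" "e \<in> Idp S" "e \<noteq> szero S"
  shows "ideal_cong I \<noteq> Id_on (carrier S)"
proof -
  have "(e, szero S) \<in> ideal_cong I"
    by (rule ideal_congI[OF _ _ e(1)]) (use e in \<open>simp_all add: Idp_commute[of e]\<close>)
  then show ?thesis using e(3) by auto
qed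

text \<open>The witnesses \<open>e\<close> and \<open>f\<close> satisfy \<open>e f \<in> I \<inter> J\<close>, so they are orthogonal.  An idempotent \<open>h\<close> is
  the orthogonal join of \<open>h f\<close>, where \<open>x\<close> and \<open>y\<close> agree by the choice of \<open>e\<close>, and \<open>h - f\<close>, where they
  agree by the choice of \<open>f\<close>.\<close>

lemma ideal_cong_Int_disjoint:
  assumes I: "additive_ideal I" and J: "additive_ideal J" and IJ: "I \<inter> J \<subseteq> {szero S}"
  shows "ideal_cong I \<inter> ideal_cong J = Id_on (carrier S)"
proof (intro equalityI subsetI)
  fix p assume "p \<in> ideal_cong I \<inter> ideal_cong J"
  then obtain x y where p: "p = (x, y)" and xyI: "(x, y) \<in> ideal_cong I" and xyJ: "(x, y) \<in> ideal_cong J"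
    by (cases p) auto
  obtain e where e: "e \<in> I" "\<And>j. j \<in> Idp S \<Longrightarrow> j \<cdot> e = szero S \<Longrightarrow> x \<cdot> j = y \<cdot> j"
    and x: "x \<in> carrier S" and y: "y \<in> carrier S"
    using xyI by (auto simp: ideal_cong_def)
  obtain f where f: "f \<in> J" "\<And>j. j \<in> Idp S \<Longrightarrow> j \<cdot> f = szero S \<Longrightarrow> x \<cdot> j = y \<cdot> j"
    using xyJ by (auto simp: ideal_cong_def)
  have idp: "e \<in> Idp S" "f \<in> Idp S" using I J e(1) f(1) by (auto simp: additive_ideal_def)
  have "sinv S f \<cdot> (e \<cdot> f) \<in> I" "sinv S e \<cdot> (f \<cdot> e) \<in> J"
    using I J e(1) f(1) idp[THEN IdpD(1)] unfolding additive_ideal_def by blast+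
  moreover have "sinv S f \<cdot> (e \<cdot> f) = f \<cdot> e" using idp Idp_commute[of e f] by simp
  moreover have "sinv S e \<cdot> (f \<cdot> e) = f \<cdot> e" using idp by (simp add: Idp_left_commute[of e f])
  ultimately have fe: "f \<cdot> e = szero S" using IJ by auto
  have agree: "x \<cdot> h = y \<cdot> h" if h: "h \<in> Idp S" for h
  proof -
    note g = Idp_diff_props[OF h idp(2)]
    have "x \<cdot> f = y \<cdot> f" using e(2)[OF idp(2) fe] .
    then have "x \<cdot> (h \<cdot> f) = y \<cdot> (h \<cdot> f)"
      using x y h idp Idp_commute[of h f] by (simp flip: smult_assoc)
    moreover have "x \<cdot> Idp_diff h f = y \<cdot> Idp_diff h f"
      using g(1,2) idp by (intro f(2)) (simp_all add: Idp_commute[of _ f])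
    moreover have "h \<cdot> f \<cdot> Idp_diff h f = szero S" using g(1,2) h idp by (simp add: smult_assoc)
    ultimately have "x \<cdot> ((h \<cdot> f) \<curlyvee> Idp_diff h f) = y \<cdot> ((h \<cdot> f) \<curlyvee> Idp_diff h f)"
      using x y h idp g(1) by (intro agree_on_join) auto
    then show ?thesis using g(3) by simp
  qed
  have "x = y"
    by (rule nat_order_antisym[OF x y])
      (use agree[of "dom_idp S x"] agree[of "dom_idp S y"] x y in simp_all)
  then show "p \<in> Id_on (carrier S)" using p x by auto
next
  fix p assume "p \<in> Id_on (carrier S)"
  then show "p \<in> ideal_cong I \<inter> ideal_cong J"
    using equiv_ideal_cong[OF I] equiv_ideal_cong[OF J] by (auto simp: equiv_def refl_on_def)
qed

section \<open>Linking idempotents of a finitely subdirectly irreducible bias\<close>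

definition polar :: "'a set \<Rightarrow> 'a set" where
  "polar A = {e \<in> Idp S. \<forall>a\<in>A. \<forall>s\<in>carrier S. a \<cdot> s \<cdot> e = szero S}"

lemma additive_ideal_polar:
  assumes A: "A \<subseteq> carrier S"
  shows "additive_ideal (polar A)"
proof -
  have "p \<cdot> (e \<curlyvee> f) = szero S"
    if p: "p \<in> carrier S" "p \<cdot> e = szero S" "p \<cdot> f = szero S" and e: "e \<in> Idp S" and f: "f \<in> Idp S"
    for p e f
  proof -
    have "dom_idp S p \<cdot> e = szero S" "dom_idp S p \<cdot> f = szero S"
      using p e f by (simp_all add: dom_idp_def smult_assoc)
    then have "dom_idp S p \<cdot> (e \<curlyvee> f) = szero S" using p(1) e f by (simp add: Idp_mult_join)
    then have "p \<cdot> dom_idp S p \<cdot> (e \<curlyvee> f) = szero S"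
      using p(1) e f by (simp add: smult_assoc del: mult_dom_idp)
    then show ?thesis using p(1) by simp
  qed
  moreover have "a \<cdot> s \<cdot> (sinv S t \<cdot> (e \<cdot> t)) = szero S"
    if a: "a \<in> A" and s: "s \<in> carrier S" and e: "e \<in> polar A" and t: "t \<in> carrier S" for a s e t
  proof -
    have "a \<in> carrier S" "e \<in> carrier S" using a e A by (auto simp: polar_def)
    then have "a \<cdot> s \<cdot> (sinv S t \<cdot> (e \<cdot> t)) = a \<cdot> (s \<cdot> sinv S t) \<cdot> e \<cdot> t"
      using s t by (simp add: smult_assoc)
    then show ?thesis using a s e t by (simp add: polar_def)
  qed
  ultimately show ?thesis
    using A by (auto simp: additive_ideal_def polar_def subset_iff)
qed

text \<open>Otherwise the polar of \<open>a\<close>, which contains \<open>b\<close>, and its own polar, which contains \<open>a\<close>, yield two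
  nonidentity congruences that intersect in the identity.\<close>

lemma ex_nonzero_between:
  assumes fsi: "finitely_subdirectly_irreducible S"
    and a: "a \<in> Idp S" "a \<noteq> szero S" and b: "b \<in> Idp S" "b \<noteq> szero S"
  shows "\<exists>s\<in>carrier S. a \<cdot> s \<cdot> b \<noteq> szero S"
proof (rule ccontr)
  assume none: "\<not> ?thesis"
  let ?I = "polar {a}"
  let ?J = "polar ?I"
  have Isub: "?I \<subseteq> carrier S" by (auto simp: polar_def)
  have I: "additive_ideal ?I" and J: "additive_ideal ?J"
    using a Isub by (simp_all add: additive_ideal_polar)
  have bI: "b \<in> ?I" using none b by (auto simp: polar_def)
  have "c \<cdot> s \<cdot> a = szero S" if c: "c \<in> ?I" and s: "s \<in> carrier S" for c s
  proof -
    have cI: "c \<in> Idp S" using c by (simp add: polar_def)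
    have "a \<cdot> sinv S s \<cdot> c = szero S" using c s by (simp add: polar_def)
    moreover have "sinv S (a \<cdot> sinv S s \<cdot> c) = c \<cdot> s \<cdot> a"
      using a cI s by (simp add: sinv_mult smult_assoc)
    ultimately show ?thesis by (metis sinv_Idp szero_Idp)
  qed
  then have aJ: "a \<in> ?J" using a by (simp add: polar_def)
  have "?I \<inter> ?J \<subseteq> {szero S}"
  proof
    fix e assume e: "e \<in> ?I \<inter> ?J"
    then have eI: "e \<in> ?I" "e \<in> ?J" and idp: "e \<in> Idp S" by (auto simp: polar_def)
    have "e \<cdot> e \<cdot> e = szero S" using eI(2) IdpD(1)[OF idp] eI(1) unfolding polar_def[of ?I] by blast
    then show "e \<in> {szero S}" using idp by simp
  qed
  then have "ideal_cong ?I \<inter> ideal_cong ?J = Id_on (carrier S)"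
    by (rule ideal_cong_Int_disjoint[OF I J])
  moreover have "ideal_cong ?I \<noteq> Id_on (carrier S)" "ideal_cong ?J \<noteq> Id_on (carrier S)"
    using ideal_cong_nontrivial[OF bI b] ideal_cong_nontrivial[OF aJ a] .
  ultimately show False
    using fsi bias_congruence_ideal_cong[OF I] bias_congruence_ideal_cong[OF J]
    unfolding finitely_subdirectly_irreducible_def by blast
qed

section \<open>The type monoid\<close>

abbreviation D_class :: "'a \<Rightarrow> 'a set" where
  "D_class x \<equiv> green_D S `` {x}"

abbreviation Typ_class :: "'a set multiset \<Rightarrow> 'a set multiset set" where
  "Typ_class \<equiv> univ_class (Int_dim S) (Int_add S) (D_class (szero S))"

abbreviation Typ_cong :: "('a set multiset \<times> 'a set multiset) set" where
  "Typ_cong \<equiv> univ_cong (Int_dim S) (Int_add S) (D_class (szero S))"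

lemma D_class_Int_dim [simp, intro]: "x \<in> carrier S \<Longrightarrow> D_class x \<in> Int_dim S"
  by (simp add: Int_dim_def quotientI)

lemma D_class_eq_iff:
  "x \<in> carrier S \<Longrightarrow> y \<in> carrier S \<Longrightarrow> D_class x = D_class y \<longleftrightarrow> (x, y) \<in> green_D S"
  using eq_equiv_class_iff[OF equiv_green_D] by simp

lemma D_class_self: "x \<in> carrier S \<Longrightarrow> x \<in> D_class x"
  by (rule equiv_class_self[OF equiv_green_D])

lemma D_class_of_mem:
  assumes "X \<in> Int_dim S" "x \<in> X"
  shows "x \<in> carrier S" "D_class x = X"
proof -
  obtain c where c: "c \<in> carrier S" "X = D_class c"
    using assms(1) by (auto simp: Int_dim_def elim: quotientE)
  then have cx: "(c, x) \<in> green_D S" using assms(2) by simp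
  then show "x \<in> carrier S" by (auto simp: green_D_iff)
  show "D_class x = X" using equiv_class_eq[OF equiv_green_D cx] c(2) by simp
qed

lemma osum_eq_szero_iff:
  assumes x: "x \<in> carrier S" and y: "y \<in> carrier S" and xy: "orthogonal S x y"
  shows "osum S x y = szero S \<longleftrightarrow> x = szero S \<and> y = szero S"
proof
  assume "osum S x y = szero S"
  then show "x = szero S \<and> y = szero S"
    using osum_props(2,3)[OF x y xy] x y by (metis IdpD(1) dom_idp_closed szero_left)
next
  assume "x = szero S \<and> y = szero S"
  then show "osum S x y = szero S"
    using xy by (intro osum_unique) auto
qed

lemma Int_add_eq_zero_iff:
  assumes X: "X \<in> Int_dim S" and Y: "Y \<in> Int_dim S" and add: "Int_add S X Y W"
  shows "W = D_class (szero S) \<longleftrightarrow> X = D_class (szero S) \<and> Y = D_class (szero S)"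
proof -
  obtain x y where x: "x \<in> X" and y: "y \<in> Y" and xy: "orthogonal S x y"
    and W: "W = D_class (osum S x y)"
    using add by (auto simp: Int_add_def)
  note x' = D_class_of_mem[OF X x] and y' = D_class_of_mem[OF Y y]
  have zero: "D_class u = D_class (szero S) \<longleftrightarrow> u = szero S" if "u \<in> carrier S" for u
    using that by (simp add: D_class_eq_iff green_D_szero)
  show ?thesis
    using osum_eq_szero_iff[OF x'(1) y'(1) xy] zero[OF x'(1)] zero[OF y'(1)]
      zero[OF osum_props(1)[OF x'(1) y'(1) xy]] x'(2) y'(2) W
    by simp
qed

text \<open>The statement is an invariant of every generator of the congruence; for a relation
  \<open>W = X + Y\<close> it holds because an orthogonal sum vanishes only if both summands do.\<close>

lemma Typ_cong_zero_iff:
  assumes "(A, B) \<in> Typ_cong"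
  shows "set_mset A \<subseteq> {D_class (szero S)} \<longleftrightarrow> set_mset B \<subseteq> {D_class (szero S)}"
  using assms
proof induction
  case (sum x y w)
  then show ?case using Int_add_eq_zero_iff[of x y w] by simp
qed auto

lemma Typ_class_eq_zero_iff:
  assumes A: "set_mset A \<subseteq> Int_dim S"
  shows "Typ_class A = Typ_class {#} \<longleftrightarrow> set_mset A \<subseteq> {D_class (szero S)}"
proof
  assume "Typ_class A = Typ_class {#}"
  then have "(A, {#}) \<in> Typ_cong" using A by (simp add: univ_class_eq_iff)
  then show "set_mset A \<subseteq> {D_class (szero S)}" using Typ_cong_zero_iff by fastforce
next
  assume "set_mset A \<subseteq> {D_class (szero S)}"
  then have "(A, {#}) \<in> Typ_cong"
  proof (induction A)
    case empty
    show ?case by (rule univ_cong.refl) simp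
  next
    case (add X A)
    have "({#X#} + A, {#} + {#}) \<in> Typ_cong"
      using add by (intro univ_cong.plus) (auto intro: univ_cong.zero)
    then show ?case by simp
  qed
  then show "Typ_class A = Typ_class {#}" using A by (simp add: univ_class_eq_iff)
qed

lemma conical_Typ: "conical (Typ S)"
  unfolding conical_def Typ_def
  by (auto simp: carrier_univ_monoid one_univ_monoid mult_univ_monoid Typ_class_eq_zero_iff)

lemma osum_restrict:
  assumes c: "c \<in> carrier S" and e: "e \<in> Idp S" and le: "dom_idp S c \<cdot> e = e"
  shows "orthogonal S (c \<cdot> e) (c \<cdot> Idp_diff (dom_idp S c) e)"
    "osum S (c \<cdot> e) (c \<cdot> Idp_diff (dom_idp S c) e) = c"
proof -
  let ?d = "dom_idp S c"
  let ?g = "Idp_diff ?d e"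
  have d: "?d \<in> Idp S" using c by simp
  note g = Idp_diff_props[OF d e]
  have "sinv S (c \<cdot> e) \<cdot> (c \<cdot> ?g) = e \<cdot> (?d \<cdot> ?g)"
    using c e g(1) by (simp add: sinv_mult dom_idp_def smult_assoc)
  moreover have "c \<cdot> e \<cdot> sinv S (c \<cdot> ?g) = c \<cdot> (e \<cdot> ?g \<cdot> sinv S c)"
    using c e g(1) by (simp add: sinv_mult smult_assoc)
  ultimately show orth: "orthogonal S (c \<cdot> e) (c \<cdot> ?g)"
    using c g(2,4) by (simp add: orthogonal_def)
  show "osum S (c \<cdot> e) (c \<cdot> ?g) = c"
    by (rule osum_unique[OF _ _ orth])
      (use c e g le restrict_dom_idp[of e c] restrict_dom_idp[of ?g c] in simp_all)
qed

text \<open>The class of \<open>c\<close> is the sum of the classes of \<open>c e\<close>, which is \<open>\<D>\<close>-equivalent to its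
  domain \<open>e\<close>, and of \<open>c (d(c) - e)\<close>.\<close>

lemma Typ_class_below:
  assumes A: "set_mset A \<subseteq> Int_dim S" and mem: "D_class c \<in># A" and c: "c \<in> carrier S"
    and e: "e \<in> Idp S" and le: "dom_idp S c \<cdot> e = e"
  shows "alg_le (Typ S) (Typ_class {#D_class e#}) (Typ_class A)"
proof -
  let ?y = "c \<cdot> e" and ?y' = "c \<cdot> Idp_diff (dom_idp S c) e"
  have y: "?y \<in> carrier S" "?y' \<in> carrier S" using c e by (auto simp: Idp_diff_props(1))
  have "D_class ?y = D_class (dom_idp S ?y)"
    using y c e green_D_dom_rng(1)[of ?y] by (simp add: D_class_eq_iff)
  also have "dom_idp S ?y = e" using c e le by (simp add: restrict_dom_idp)
  finally have ye: "D_class ?y = D_class e" .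
  obtain B where B: "A = {#D_class c#} + B" using mem by (auto dest: multi_member_split)
  have "Int_add S (D_class e) (D_class ?y') (D_class c)"
    unfolding Int_add_def using osum_restrict[OF c e le] D_class_self y ye by metis
  then have "({#D_class c#}, {#D_class e, D_class ?y'#}) \<in> Typ_cong"
    using c e y by (intro univ_cong.sum) auto
  then have "(A, {#D_class e, D_class ?y'#} + B) \<in> Typ_cong"
    using A unfolding B by (intro univ_cong.plus univ_cong.refl) auto
  then have "Typ_class A = Typ_class ({#D_class e#} + ({#D_class ?y'#} + B))"
    using A e y B by (subst univ_class_eq_iff) (auto simp: add_mset_commute)
  also have "\<dots> = Typ_class {#D_class e#} \<otimes>\<^bsub>Typ S\<^esub> Typ_class ({#D_class ?y'#} + B)"
    unfolding Typ_def using A e y B by (subst mult_univ_monoid) auto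
  finally have eq: "Typ_class {#D_class e#} \<otimes>\<^bsub>Typ S\<^esub> Typ_class ({#D_class ?y'#} + B) = Typ_class A" ..
  have "Typ_class ({#D_class ?y'#} + B) \<in> carrier (Typ S)"
    unfolding Typ_def carrier_univ_monoid using A y B by (intro imageI) auto
  then show ?thesis using eq unfolding alg_le_def by blast
qed

lemma Typ_nonzero_summand:
  assumes "X \<in> carrier (Typ S)" "X \<noteq> \<one>\<^bsub>Typ S\<^esub>"
  obtains A c where "X = Typ_class A" "set_mset A \<subseteq> Int_dim S" "D_class c \<in># A"
    "c \<in> carrier S" "c \<noteq> szero S"
proof -
  obtain A where A: "X = Typ_class A" "set_mset A \<subseteq> Int_dim S"
    using assms(1) by (auto simp: Typ_def carrier_univ_monoid)
  then have "\<not> set_mset A \<subseteq> {D_class (szero S)}"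
    using assms(2) Typ_class_eq_zero_iff[OF A(2)] by (simp add: Typ_def one_univ_monoid)
  then obtain P where P: "P \<in># A" "P \<noteq> D_class (szero S)" by blast
  then obtain c where "c \<in> carrier S" "P = D_class c"
    using A(2) by (auto simp: Int_dim_def elim: quotientE)
  then show thesis using that A P by blast
qed

end

section \<open>Primeness\<close>

theorem lemma5p5:
  fixes S :: "('a, 'm) semigroup0_scheme"
  assumes "bias S"
    and "finitely_subdirectly_irreducible S"
  shows "prime_monoid (Typ S)"
proof -
  interpret boolean_inverse_semigroup S by (rule assms(1))
  have "\<exists>w \<in> carrier (Typ S) - {\<one>\<^bsub>Typ S\<^esub>}. alg_le (Typ S) w X \<and> alg_le (Typ S) w Y"
    if X: "X \<in> carrier (Typ S) - {\<one>\<^bsub>Typ S\<^esub>}" and Y: "Y \<in> carrier (Typ S) - {\<one>\<^bsub>Typ S\<^esub>}" for X Y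
  proof -
    obtain A c where A: "X = Typ_class A" "set_mset A \<subseteq> Int_dim S" "D_class c \<in># A"
      and c: "c \<in> carrier S" "c \<noteq> szero S"
      using X Typ_nonzero_summand by blast
    obtain B d where B: "Y = Typ_class B" "set_mset B \<subseteq> Int_dim S" "D_class d \<in># B"
      and d: "d \<in> carrier S" "d \<noteq> szero S"
      using Y Typ_nonzero_summand by blast
    let ?a = "dom_idp S c" and ?b = "dom_idp S d"
    have a: "?a \<in> Idp S" "?a \<noteq> szero S" and b: "?b \<in> Idp S" "?b \<noteq> szero S"
      using c d by (simp_all add: dom_idp_def dom_idp_szero_iff)
    obtain s where s: "s \<in> carrier S" "?a \<cdot>\<^bsub>S\<^esub> s \<cdot>\<^bsub>S\<^esub> ?b \<noteq> szero S"
      using ex_nonzero_between[OF assms(2) a b] by blast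
    define x where "x = ?a \<cdot>\<^bsub>S\<^esub> s \<cdot>\<^bsub>S\<^esub> ?b"
    have x: "x \<in> carrier S" "x \<noteq> szero S" using a b s by (simp_all add: x_def)
    have ax: "?a \<cdot>\<^bsub>S\<^esub> x = x" using a b s by (simp add: x_def smult_assoc)
    have xb: "x \<cdot>\<^bsub>S\<^esub> ?b = x" using a b s by (simp add: x_def smult_assoc)
    have r: "rng_idp S x \<in> Idp S" "?a \<cdot>\<^bsub>S\<^esub> rng_idp S x = rng_idp S x"
      using x(1) a ax by (simp_all add: rng_idp_def flip: smult_assoc)
    have q: "dom_idp S x \<in> Idp S" "?b \<cdot>\<^bsub>S\<^esub> dom_idp S x = dom_idp S x"
      using x(1) b xb restrict_dom_idp[of ?b x] Idp_commute[of ?b "dom_idp S x"] by simp_all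
    have Dx: "D_class (rng_idp S x) = D_class x" "D_class (dom_idp S x) = D_class x"
      using green_D_dom_rng[OF x(1)] D_class_eq_iff x(1) r(1) q(1) by (metis IdpD(1))+
    let ?w = "Typ_class {#D_class x#}"
    have "alg_le (Typ S) ?w X" using Typ_class_below[OF A(2,3) c(1) r] Dx A(1) by simp
    moreover have "alg_le (Typ S) ?w Y" using Typ_class_below[OF B(2,3) d(1) q] Dx B(1) by simp
    moreover have "?w \<in> carrier (Typ S)" using x(1) by (simp add: Typ_def carrier_univ_monoid)
    moreover have "?w \<noteq> \<one>\<^bsub>Typ S\<^esub>"
      using x by (simp add: Typ_def one_univ_monoid Typ_class_eq_zero_iff D_class_eq_iff green_D_szero)
    ultimately show ?thesis by blast
  qed
  then show ?thesis
    using conical_Typ comm_monoid_univ_monoid by (auto simp: prime_monoid_def Typ_def)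
qed

end
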